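(* Let $\mathcal{C}$ be a skeletally small, idempotent complete triangulated category with suspension $[1]$, let $n\ge 2$, and let $\mathcal{X}\subseteq\mathcal{C}$ be an $n$-cluster tilting subcategory. Then there is an isomorphism of abelian groups $$K_0(\mathcal{C}^{\mathcal{X}}_R)\xrightarrow{\ \cong\ }K_0^{\mathsf{sp}}(\mathcal{X}),\qquad [C]^{\mathcal{X}}_R\longmapsto\sum_{i=0}^{n-1}(-1)^i[X_i]^{\mathsf{sp}},$$ where $C\in\mathcal{C}$ admits an $\mathcal{X}$-resolution $X_{n-1}\to\cdots\to X_1\to X_0\to C$ in $\mathcal{C}^{\mathcal{X}}_R$ of length $n-1$; its inverse is given by $[X]^{\mathsf{sp}}\mapsto[X]^{\mathcal{X}}_R$ for $X\in\mathcal{X}$.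
   Context: A full subcategory $\mathcal{X}\subseteq\mathcal{C}$ is $n$-cluster tilting if it is functorially finite in $\mathcal{C}$ and $\mathcal{X}=\{C\in\mathcal{C}\mid\mathcal{C}(\mathcal{X},C[i])=0,\ 1\le i\le n-1\}=\{C\in\mathcal{C}\mid\mathcal{C}(C,\mathcal{X}[i])=0,\ 1\le i\le n-1\}$. For $A,C\in\mathcal{C}$ let $\mathbb{E}^{\mathcal{X}}_R(C,A)=\{h\colon C\to A[1]\mid hx=0\text{ for all }x\colon X\to C\text{ with }X\in\mathcal{X}\}$. This defines an extriangulated structure $\mathcal{C}^{\mathcal{X}}_R=(\mathcal{C},\mathbb{E}^{\mathcal{X}}_R,\mathfrak{s}^{\mathcal{X}}_R)$ whose conflations are the sequences $A\to B\to C$ that are part of a triangle $A\to B\to C\xrightarrow{h}A[1]$ with $h\in\mathbb{E}^{\mathcal{X}}_R(C,A)$. $K_0(\mathcal{C}^{\mathcal{X}}_R)$ is the abelian group generated by isomorphism classes of objects of $\mathcal{C}$ modulo $[A]-[B]+[C]$ for all these conflations; $[C]^{\mathcal{X}}_R$ is the class of $C$. $K_0^{\mathsf{sp}}(\mathcal{X})$ is the split Grothendieck group: generators $[X]^{\mathsf{sp}}$ for isomorphism classes of $X\in\mathcal{X}$, relations $[X\oplus X']^{\mathsf{sp}}=[X]^{\mathsf{sp}}+[X']^{\mathsf{sp}}$. An $\mathcal{X}$-resolution of length $m$ of $C$ in $\mathcal{C}^{\mathcal{X}}_R$ is a complex $X_m\to\cdots\to X_0\to C$ with $X_i\in\mathcal{X}$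 obtained by splicing conflations $C_{i+1}\to X_i\to C_i$ of $\mathcal{C}^{\mathcal{X}}_R$, $0\le i\le m-1$, with $C_0=C$ and $C_m=X_m$. It is known that for $\mathcal{X}$ $n$-cluster tilting every $C\in\mathcal{C}$ has such a resolution of length $n-1$. *)

theory Defs
  imports "HOL-Algebra.Free_Abelian_Groups" "HOL-Algebra.Generated_Groups"
begin

section \<open>Additive categories\<close>

text \<open>
  The objects of a category form a set over a type, so every category here is small and its
  isomorphism classes form a set: a skeletally small category is represented by a small category
  equivalent to it, and skeletal smallness is not a separate hypothesis.
\<close>

record ('o, 'm) category =
  Obj :: "'o set"
  Arr :: "'m set"
  Dom :: "'m \<Rightarrow> 'o"
  Cod :: "'m \<Rightarrow> 'o"
  Ide :: "'o \<Rightarrow> 'm"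
  Comp :: "'m \<Rightarrow> 'm \<Rightarrow> 'm"  (infixr \<open>\<cdot>\<index>\<close> 70)

definition Hom :: "('o, 'm, 'z) category_scheme \<Rightarrow> 'o \<Rightarrow> 'o \<Rightarrow> 'm set"
  where "Hom \<C> A B = {f \<in> Arr \<C>. Dom \<C> f = A \<and> Cod \<C> f = B}"

locale category =
  fixes \<C> :: "('o, 'm, 'z) category_scheme" (structure)
  assumes Dom_Obj: "f \<in> Arr \<C> \<Longrightarrow> Dom \<C> f \<in> Obj \<C>"
    and Cod_Obj: "f \<in> Arr \<C> \<Longrightarrow> Cod \<C> f \<in> Obj \<C>"
    and Ide_Hom: "A \<in> Obj \<C> \<Longrightarrow> Ide \<C> A \<in> Hom \<C> A A"
    and Comp_Hom: "\<lbrakk>f \<in> Hom \<C> A B; g \<in> Hom \<C> B C\<rbrakk> \<Longrightarrow> g \<cdot> f \<in> Hom \<C> A C"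
    and Comp_Ide: "f \<in> Hom \<C> A B \<Longrightarrow> f \<cdot> Ide \<C> A = f"
    and Ide_Comp: "f \<in> Hom \<C> A B \<Longrightarrow> Ide \<C> B \<cdot> f = f"
    and Comp_assoc: "\<lbrakk>f \<in> Hom \<C> A B; g \<in> Hom \<C> B C; h \<in> Hom \<C> C D\<rbrakk>
      \<Longrightarrow> (h \<cdot> g) \<cdot> f = h \<cdot> (g \<cdot> f)"

definition is_iso_arr :: "('o, 'm, 'z) category_scheme \<Rightarrow> 'm \<Rightarrow> bool"
  where "is_iso_arr \<C> f \<longleftrightarrow> (\<exists>A B g. f \<in> Hom \<C> A B \<and> g \<in> Hom \<C> B A \<and>
    g \<cdot>\<^bsub>\<C>\<^esub> f = Ide \<C> A \<and> f \<cdot>\<^bsub>\<C>\<^esub> g = Ide \<C> B)"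

definition isomorphic_obj :: "('o, 'm, 'z) category_scheme \<Rightarrow> 'o \<Rightarrow> 'o \<Rightarrow> bool"
  where "isomorphic_obj \<C> A B \<longleftrightarrow> (\<exists>f \<in> Hom \<C> A B. is_iso_arr \<C> f)"

definition idempotent_complete :: "('o, 'm, 'z) category_scheme \<Rightarrow> bool"
  where "idempotent_complete \<C> \<longleftrightarrow>
    (\<forall>A \<in> Obj \<C>. \<forall>e \<in> Hom \<C> A A. e \<cdot>\<^bsub>\<C>\<^esub> e = e \<longrightarrow>
      (\<exists>B \<in> Obj \<C>. \<exists>r \<in> Hom \<C> A B. \<exists>s \<in> Hom \<C> B A.
        s \<cdot>\<^bsub>\<C>\<^esub> r = e \<and> r \<cdot>\<^bsub>\<C>\<^esub> s = Ide \<C> B))"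

record ('o, 'm) preadditive_category = "('o, 'm) category" +
  Add :: "'m \<Rightarrow> 'm \<Rightarrow> 'm"
  Zero :: "'o \<Rightarrow> 'o \<Rightarrow> 'm"

text \<open>Abelian groups are written multiplicatively, so sums become products and multiples become powers.\<close>

definition Hom_group :: "('o, 'm, 'z) preadditive_category_scheme \<Rightarrow> 'o \<Rightarrow> 'o \<Rightarrow> 'm monoid"
  where "Hom_group \<C> A B =
    \<lparr>carrier = Hom \<C> A B, monoid.mult = Add \<C>, one = Zero \<C> A B\<rparr>"

definition Neg :: "('o, 'm, 'z) preadditive_category_scheme \<Rightarrow> 'm \<Rightarrow> 'm"
  where "Neg \<C> f = inv\<^bsub>Hom_group \<C> (Dom \<C> f) (Cod \<C> f)\<^esub> f"

definition is_zero_obj :: "('o, 'm, 'z) preadditive_category_scheme \<Rightarrow> 'o \<Rightarrow> bool"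
  where "is_zero_obj \<C> Z \<longleftrightarrow> Z \<in> Obj \<C> \<and>
    (\<forall>A \<in> Obj \<C>. Hom \<C> A Z = {Zero \<C> A Z} \<and> Hom \<C> Z A = {Zero \<C> Z A})"

definition is_direct_sum :: "('o, 'm, 'z) preadditive_category_scheme \<Rightarrow> 'o \<Rightarrow> 'o \<Rightarrow> 'o \<Rightarrow> bool"
  where "is_direct_sum \<C> A B S \<longleftrightarrow>
    (\<exists>i \<in> Hom \<C> A S. \<exists>j \<in> Hom \<C> B S. \<exists>p \<in> Hom \<C> S A. \<exists>q \<in> Hom \<C> S B.
      p \<cdot>\<^bsub>\<C>\<^esub> i = Ide \<C> A \<and> q \<cdot>\<^bsub>\<C>\<^esub> j = Ide \<C> B \<and>
      p \<cdot>\<^bsub>\<C>\<^esub> j = Zero \<C> B A \<and> q \<cdot>\<^bsub>\<C>\<^esub> i = Zero \<C> A B \<and>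
      Add \<C> (i \<cdot>\<^bsub>\<C>\<^esub> p) (j \<cdot>\<^bsub>\<C>\<^esub> q) = Ide \<C> S)"

locale additive_category = category \<C>
  for \<C> :: "('o, 'm, 'z) preadditive_category_scheme" (structure) +
  assumes Hom_comm_group: "\<lbrakk>A \<in> Obj \<C>; B \<in> Obj \<C>\<rbrakk> \<Longrightarrow> comm_group (Hom_group \<C> A B)"
    and Comp_Add: "\<lbrakk>f \<in> Hom \<C> A B; f' \<in> Hom \<C> A B; g \<in> Hom \<C> B C\<rbrakk>
      \<Longrightarrow> g \<cdot> Add \<C> f f' = Add \<C> (g \<cdot> f) (g \<cdot> f')"
    and Add_Comp: "\<lbrakk>f \<in> Hom \<C> A B; g \<in> Hom \<C> B C; g' \<in> Hom \<C> B C\<rbrakk>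
      \<Longrightarrow> Add \<C> g g' \<cdot> f = Add \<C> (g \<cdot> f) (g' \<cdot> f)"
    and zero_obj_exists: "\<exists>Z. is_zero_obj \<C> Z"
    and direct_sum_exists: "\<lbrakk>A \<in> Obj \<C>; B \<in> Obj \<C>\<rbrakk> \<Longrightarrow> \<exists>S \<in> Obj \<C>. is_direct_sum \<C> A B S"


section \<open>Triangulated categories\<close>

text \<open>
  \<open>Sh\<close> and \<open>ShArr\<close> are the suspension \<open>[1]\<close> on objects and on morphisms;
  \<open>Dist f g h\<close> says that \<open>A \<rightarrow> B \<rightarrow> C \<rightarrow> A[1]\<close> with maps \<open>f\<close>, \<open>g\<close>, \<open>h\<close> is a distinguished triangle.
\<close>

record ('o, 'm) triangulated_category = "('o, 'm) preadditive_category" +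
  Sh :: "'o \<Rightarrow> 'o"
  ShArr :: "'m \<Rightarrow> 'm"
  Dist :: "'m \<Rightarrow> 'm \<Rightarrow> 'm \<Rightarrow> bool"

text \<open>
  The suspension is only required to be an additive autoequivalence (additive, fully faithful and
  essentially surjective), which covers the convention that it is an automorphism.
\<close>

locale suspended_category = additive_category \<C>
  for \<C> :: "('o, 'm, 'z) triangulated_category_scheme" (structure) +
  assumes Sh_Obj: "A \<in> Obj \<C> \<Longrightarrow> Sh \<C> A \<in> Obj \<C>"
    and ShArr_Ide: "A \<in> Obj \<C> \<Longrightarrow> ShArr \<C> (Ide \<C> A) = Ide \<C> (Sh \<C> A)"
    and ShArr_Comp: "\<lbrakk>f \<in> Hom \<C> A B; g \<in> Hom \<C> B C\<rbrakk>
      \<Longrightarrow> ShArr \<C> (g \<cdot> f) = ShArr \<C> g \<cdot> ShArr \<C> f"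
    and ShArr_Add: "\<lbrakk>f \<in> Hom \<C> A B; g \<in> Hom \<C> A B\<rbrakk>
      \<Longrightarrow> ShArr \<C> (Add \<C> f g) = Add \<C> (ShArr \<C> f) (ShArr \<C> g)"
    and ShArr_bij: "\<lbrakk>A \<in> Obj \<C>; B \<in> Obj \<C>\<rbrakk>
      \<Longrightarrow> bij_betw (ShArr \<C>) (Hom \<C> A B) (Hom \<C> (Sh \<C> A) (Sh \<C> B))"
    and Sh_ess_surj: "B \<in> Obj \<C> \<Longrightarrow> \<exists>A \<in> Obj \<C>. isomorphic_obj \<C> (Sh \<C> A) B"

locale triangulated_category = suspended_category \<C>
  for \<C> :: "('o, 'm, 'z) triangulated_category_scheme" (structure) +
  assumes Dist_Hom: "Dist \<C> f g h \<Longrightarrow>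
      \<exists>A B C. f \<in> Hom \<C> A B \<and> g \<in> Hom \<C> B C \<and> h \<in> Hom \<C> C (Sh \<C> A)"
    and TR1_iso: "\<lbrakk>Dist \<C> f g h;
        f \<in> Hom \<C> A B; g \<in> Hom \<C> B C; h \<in> Hom \<C> C (Sh \<C> A);
        f' \<in> Hom \<C> A' B'; g' \<in> Hom \<C> B' C'; h' \<in> Hom \<C> C' (Sh \<C> A');
        a \<in> Hom \<C> A A'; b \<in> Hom \<C> B B'; c \<in> Hom \<C> C C';
        is_iso_arr \<C> a; is_iso_arr \<C> b; is_iso_arr \<C> c;
        b \<cdot> f = f' \<cdot> a; c \<cdot> g = g' \<cdot> b; ShArr \<C> a \<cdot> h = h' \<cdot> c\<rbrakk>
      \<Longrightarrow> Dist \<C> f' g' h'"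
    and TR1_ide: "\<lbrakk>A \<in> Obj \<C>; is_zero_obj \<C> Z\<rbrakk>
      \<Longrightarrow> Dist \<C> (Ide \<C> A) (Zero \<C> A Z) (Zero \<C> Z (Sh \<C> A))"
    and TR1_cone: "f \<in> Arr \<C> \<Longrightarrow> \<exists>g h. Dist \<C> f g h"
    and TR2: "\<lbrakk>f \<in> Hom \<C> A B; g \<in> Hom \<C> B C; h \<in> Hom \<C> C (Sh \<C> A)\<rbrakk>
      \<Longrightarrow> Dist \<C> f g h \<longleftrightarrow> Dist \<C> g h (Neg \<C> (ShArr \<C> f))"
    and TR3: "\<lbrakk>Dist \<C> f g h; Dist \<C> f' g' h';
        f \<in> Hom \<C> A B; g \<in> Hom \<C> B C; f' \<in> Hom \<C> A' B'; g' \<in> Hom \<C> B' C';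
        a \<in> Hom \<C> A A'; b \<in> Hom \<C> B B'; b \<cdot> f = f' \<cdot> a\<rbrakk>
      \<Longrightarrow> \<exists>c \<in> Hom \<C> C C'. c \<cdot> g = g' \<cdot> b \<and> ShArr \<C> a \<cdot> h = h' \<cdot> c"
    and TR4: "\<lbrakk>f \<in> Hom \<C> A B; g \<in> Hom \<C> B C;
        Dist \<C> f p u; p \<in> Hom \<C> B P;
        Dist \<C> (g \<cdot> f) q v; q \<in> Hom \<C> C Q;
        Dist \<C> g r w; r \<in> Hom \<C> C R\<rbrakk>
      \<Longrightarrow> \<exists>s \<in> Hom \<C> P Q. \<exists>t \<in> Hom \<C> Q R.
          Dist \<C> s t (ShArr \<C> p \<cdot> w) \<and>
          s \<cdot> p = q \<cdot> g \<and> v \<cdot> s = u \<and>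
          t \<cdot> q = r \<and> w \<cdot> t = ShArr \<C> f \<cdot> v"


section \<open>Cluster tilting subcategories\<close>

text \<open>A full subcategory is given by its set \<open>\<X>\<close> of objects.\<close>

definition contravariantly_finite :: "('o, 'm, 'z) category_scheme \<Rightarrow> 'o set \<Rightarrow> bool"
  where "contravariantly_finite \<C> \<X> \<longleftrightarrow>
    (\<forall>C \<in> Obj \<C>. \<exists>X \<in> \<X>. \<exists>x \<in> Hom \<C> X C.
      \<forall>Y \<in> \<X>. \<forall>y \<in> Hom \<C> Y C. \<exists>z \<in> Hom \<C> Y X. y = x \<cdot>\<^bsub>\<C>\<^esub> z)"

definition covariantly_finite :: "('o, 'm, 'z) category_scheme \<Rightarrow> 'o set \<Rightarrow> bool"
  where "covariantly_finite \<C> \<X> \<longleftrightarrow>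
    (\<forall>C \<in> Obj \<C>. \<exists>X \<in> \<X>. \<exists>x \<in> Hom \<C> C X.
      \<forall>Y \<in> \<X>. \<forall>y \<in> Hom \<C> C Y. \<exists>z \<in> Hom \<C> X Y. y = z \<cdot>\<^bsub>\<C>\<^esub> x)"

definition functorially_finite :: "('o, 'm, 'z) category_scheme \<Rightarrow> 'o set \<Rightarrow> bool"
  where "functorially_finite \<C> \<X> \<longleftrightarrow> contravariantly_finite \<C> \<X> \<and> covariantly_finite \<C> \<X>"

definition cluster_tilting :: "('o, 'm, 'z) triangulated_category_scheme \<Rightarrow> nat \<Rightarrow> 'o set \<Rightarrow> bool"
  where "cluster_tilting \<C> n \<X> \<longleftrightarrow>
    \<X> \<subseteq> Obj \<C> \<and> functorially_finite \<C> \<X> \<and>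
    \<X> = {C \<in> Obj \<C>. \<forall>X \<in> \<X>. \<forall>i \<in> {1..n-1}.
           Hom \<C> X ((Sh \<C> ^^ i) C) = {Zero \<C> X ((Sh \<C> ^^ i) C)}} \<and>
    \<X> = {C \<in> Obj \<C>. \<forall>X \<in> \<X>. \<forall>i \<in> {1..n-1}.
           Hom \<C> C ((Sh \<C> ^^ i) X) = {Zero \<C> C ((Sh \<C> ^^ i) X)}}"


section \<open>The relative extriangulated structure\<close>

definition rel_ext :: "('o, 'm, 'z) triangulated_category_scheme \<Rightarrow> 'o set \<Rightarrow> 'o \<Rightarrow> 'o \<Rightarrow> 'm set"
  where "rel_ext \<C> \<X> C A =
    {h \<in> Hom \<C> C (Sh \<C> A). \<forall>X \<in> \<X>. \<forall>x \<in> Hom \<C> X C. h \<cdot>\<^bsub>\<C>\<^esub> x = Zero \<C> X (Sh \<C> A)}"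

definition rel_conflation ::
    "('o, 'm, 'z) triangulated_category_scheme \<Rightarrow> 'o set \<Rightarrow> 'o \<Rightarrow> 'm \<Rightarrow> 'o \<Rightarrow> 'm \<Rightarrow> 'o \<Rightarrow> bool"
  where "rel_conflation \<C> \<X> A f B g C \<longleftrightarrow>
    f \<in> Hom \<C> A B \<and> g \<in> Hom \<C> B C \<and> (\<exists>h \<in> rel_ext \<C> \<X> C A. Dist \<C> f g h)"

text \<open>
  A resolution \<open>X\<^sub>m \<rightarrow> \<dots> \<rightarrow> X\<^sub>0 \<rightarrow> C\<close> with augmentation \<open>d 0\<close> and differentials
  \<open>d i : X\<^sub>i \<rightarrow> X\<^sub>i\<^sub>-\<^sub>1\<close>, spliced from conflations \<open>K (i+1) \<rightarrow> X i \<rightarrow> K i\<close> with maps \<open>f i\<close>, \<open>g i\<close>.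
  At the left end \<open>K m = X m\<close>, and \<open>g m\<close> is the identity. Values at indices above \<open>m\<close> are irrelevant.
\<close>

definition rel_resolution ::
    "('o, 'm, 'z) triangulated_category_scheme \<Rightarrow> 'o set \<Rightarrow> nat \<Rightarrow> 'o \<Rightarrow> (nat \<Rightarrow> 'o) \<Rightarrow> (nat \<Rightarrow> 'm) \<Rightarrow> bool"
  where "rel_resolution \<C> \<X> m C X d \<longleftrightarrow>
    (\<forall>i \<le> m. X i \<in> \<X>) \<and>
    (\<exists>K f g. K 0 = C \<and> K m = X m \<and> g m = Ide \<C> (X m) \<and>
      (\<forall>i < m. rel_conflation \<C> \<X> (K (Suc i)) (f i) (X i) (g i) (K i)) \<and>
      d 0 = g 0 \<and> (\<forall>i < m. d (Suc i) = f i \<cdot>\<^bsub>\<C>\<^esub> g (Suc i)))"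


section \<open>Grothendieck groups\<close>

definition presented_group :: "'a set \<Rightarrow> ('a \<Rightarrow>\<^sub>0 int) set \<Rightarrow> ('a \<Rightarrow>\<^sub>0 int) set monoid"
  where "presented_group S R = free_Abelian_group S Mod generate (free_Abelian_group S) R"

definition presented_class :: "'a set \<Rightarrow> ('a \<Rightarrow>\<^sub>0 int) set \<Rightarrow> 'a \<Rightarrow> ('a \<Rightarrow>\<^sub>0 int) set"
  where "presented_class S R a =
    generate (free_Abelian_group S) R #>\<^bsub>free_Abelian_group S\<^esub> frag_of a"

lemma comm_group_presented_group:
  assumes "R \<subseteq> carrier (free_Abelian_group S)"
  shows "comm_group (presented_group S R)"
proof -
  interpret comm_group "free_Abelian_group S" by (rule abelian_free_Abelian_group)
  show ?thesis
    unfolding presented_group_def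
    by (intro abelian_FactGroup generate_is_subgroup assms)
qed

text \<open>The isomorphism class of \<open>A\<close> in the full subcategory with objects \<open>\<S>\<close>.\<close>

definition iso_class :: "('o, 'm, 'z) category_scheme \<Rightarrow> 'o set \<Rightarrow> 'o \<Rightarrow> 'o set"
  where "iso_class \<C> \<S> A = {B \<in> \<S>. isomorphic_obj \<C> A B}"

definition K0_rel_relations ::
    "('o, 'm, 'z) triangulated_category_scheme \<Rightarrow> 'o set \<Rightarrow> ('o set \<Rightarrow>\<^sub>0 int) set"
  where "K0_rel_relations \<C> \<X> =
    {frag_of (iso_class \<C> (Obj \<C>) A) - frag_of (iso_class \<C> (Obj \<C>) B)
       + frag_of (iso_class \<C> (Obj \<C>) C) | A f B g C. rel_conflation \<C> \<X> A f B g C}"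

definition K0_rel ::
    "('o, 'm, 'z) triangulated_category_scheme \<Rightarrow> 'o set \<Rightarrow> ('o set \<Rightarrow>\<^sub>0 int) set monoid"
  where "K0_rel \<C> \<X> =
    presented_group (iso_class \<C> (Obj \<C>) ` Obj \<C>) (K0_rel_relations \<C> \<X>)"

definition K0_rel_class ::
    "('o, 'm, 'z) triangulated_category_scheme \<Rightarrow> 'o set \<Rightarrow> 'o \<Rightarrow> ('o set \<Rightarrow>\<^sub>0 int) set"
  where "K0_rel_class \<C> \<X> C =
    presented_class (iso_class \<C> (Obj \<C>) ` Obj \<C>) (K0_rel_relations \<C> \<X>)
      (iso_class \<C> (Obj \<C>) C)"

definition K0_split_relations ::
    "('o, 'm, 'z) preadditive_category_scheme \<Rightarrow> 'o set \<Rightarrow> ('o set \<Rightarrow>\<^sub>0 int) set"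
  where "K0_split_relations \<C> \<X> =
    {frag_of (iso_class \<C> \<X> S) - (frag_of (iso_class \<C> \<X> X) + frag_of (iso_class \<C> \<X> X'))
       | X X' S. X \<in> \<X> \<and> X' \<in> \<X> \<and> S \<in> \<X> \<and> is_direct_sum \<C> X X' S}"

definition K0_split ::
    "('o, 'm, 'z) preadditive_category_scheme \<Rightarrow> 'o set \<Rightarrow> ('o set \<Rightarrow>\<^sub>0 int) set monoid"
  where "K0_split \<C> \<X> = presented_group (iso_class \<C> \<X> ` \<X>) (K0_split_relations \<C> \<X>)"

definition K0_split_class ::
    "('o, 'm, 'z) preadditive_category_scheme \<Rightarrow> 'o set \<Rightarrow> 'o \<Rightarrow> ('o set \<Rightarrow>\<^sub>0 int) set"
  where "K0_split_class \<C> \<X> X =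
    presented_class (iso_class \<C> \<X> ` \<X>) (K0_split_relations \<C> \<X>) (iso_class \<C> \<X> X)"

lemma comm_group_K0_split: "comm_group (K0_split \<C> \<X>)"
proof -
  have "K0_split_relations \<C> \<X> \<subseteq> carrier (free_Abelian_group (iso_class \<C> \<X> ` \<X>))"
    unfolding K0_split_relations_def
    by (auto dest!: subsetD [OF keys_diff] subsetD [OF keys_add] split: if_splits)
  then show ?thesis
    unfolding K0_split_def by (rule comm_group_presented_group)
qed

lemma (in triangulated_category) comm_group_K0_rel: "comm_group (K0_rel \<C> \<X>)"
proof -
  have "K0_rel_relations \<C> \<X> \<subseteq> carrier (free_Abelian_group (iso_class \<C> (Obj \<C>) ` Obj \<C>))"
    unfolding K0_rel_relations_def rel_conflation_def
    by (auto simp: Hom_def intro!: imageI Dom_Obj Cod_Obj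
        dest!: subsetD [OF keys_diff] subsetD [OF keys_add] split: if_splits)
  then show ?thesis
    unfolding K0_rel_def by (rule comm_group_presented_group)
qed

end

theory Submission
  imports Defs
begin

text \<open>
  Relative to the extensions \<open>h : C \<rightarrow> A[1]\<close> that vanish on maps from \<open>\<X>\<close>, the objects of \<open>\<X>\<close> are
  projective, and the theorem is the analogue of the comparison of \<open>K\<^sub>0\<close> of a ring of finite global
  dimension with \<open>K\<^sub>0\<close> of its projective modules. A right \<open>\<X>\<close>-approximation \<open>X \<rightarrow> C\<close> is completed
  to a conflation \<open>K \<rightarrow> X \<rightarrow> C\<close>, and \<open>\<C>(\<X>, K[i])\<close> vanishes for one more \<open>i\<close> than
  \<open>\<C>(\<X>, C[i])\<close>; so \<open>n - 1\<close> steps end in \<open>\<X>\<close> (\<open>cluster_tilting_has_index\<close>). The alternating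
  sum of the terms of a resolution, its index, is then shown to be independent of the resolution and
  additive on conflations. Hence it defines a map out of the relative Grothendieck group. The
  inclusion of \<open>\<X>\<close> induces a map back, because split triangles are conflations, and the two are
  inverse because in the relative group an object is the alternating sum of any of its resolutions
  (\<open>K0_rel_isomorphic_K0_split\<close>).

  Independence is the case \<open>C \<rightarrow> C \<rightarrow> 0\<close> of additivity, so additivity is the one thing to prove
  (\<open>has_index_conflation\<close>). It rests on a single construction, the pullback of a conflation
  \<open>A \<rightarrow> B \<rightarrow> C\<close> along a conflation \<open>K \<rightarrow> X \<rightarrow> C\<close> with \<open>X \<in> \<X>\<close>: since \<open>X\<close> is projective,
  the middle object of the pullback is \<open>A \<oplus> X\<close>, and there is a conflation \<open>K \<rightarrow> A \<oplus> X \<rightarrow> B\<close>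
  (\<open>conflation_pullback\<close>). The octahedral axiom gives it without any matrix computation
  (\<open>Dist_pullback\<close>). Applied repeatedly, it replaces a conflation by one of objects with shorter
  resolutions, and an induction on the length finishes the proof.
\<close>

section \<open>Groups given by generators and relations\<close>

lemma presented_class_carrier:
  assumes "a \<in> S"
  shows "presented_class S R a \<in> carrier (presented_group S R)"
  using assms by (auto simp: presented_class_def presented_group_def FactGroup_def RCOSETS_def)

lemma presented_group_normal:
  assumes "R \<subseteq> carrier (free_Abelian_group S)"
  shows "generate (free_Abelian_group S) R \<lhd> free_Abelian_group S"
proof -
  interpret comm_group "free_Abelian_group S" by (rule abelian_free_Abelian_group)
  show ?thesis
    by (rule subgroup_imp_normal) (intro generate_is_subgroup assms)
qed

text \<open>
  The values on generators determine the extension \<open>h\<close> of \<open>\<phi>\<close> to the free group, so quantifying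
  over all extensions lets the relations be checked without naming one.
\<close>

lemma presented_group_universal:
  assumes R: "R \<subseteq> carrier (free_Abelian_group S)" and G: "comm_group G"
    and \<phi>: "\<phi> ` S \<subseteq> carrier G"
    and rel: "\<And>h r. \<lbrakk>group_hom (free_Abelian_group S) G h; \<And>a. a \<in> S \<Longrightarrow> h (frag_of a) = \<phi> a; r \<in> R\<rbrakk>
      \<Longrightarrow> h r = \<one>\<^bsub>G\<^esub>"
  obtains \<Phi> where "\<Phi> \<in> hom (presented_group S R) G"
    "\<And>a. a \<in> S \<Longrightarrow> \<Phi> (presented_class S R a) = \<phi> a"
proof -
  interpret G: comm_group G by (rule G)
  interpret F: comm_group "free_Abelian_group S" by (rule abelian_free_Abelian_group)
  obtain h where h: "h \<in> hom (free_Abelian_group S) G" "\<And>a. a \<in> S \<Longrightarrow> h (frag_of a) = \<phi> a"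
    using G.free_Abelian_group_universal [OF \<phi>] by blast
  interpret h: group_hom "free_Abelian_group S" G h
    by (simp add: group_hom_def group_hom_axioms_def h F.is_group G.is_group)
  have "R \<subseteq> kernel (free_Abelian_group S) G h"
    using R rel [OF h.group_hom_axioms h(2)] unfolding kernel_def by blast
  then have "generate (free_Abelian_group S) R \<subseteq> kernel (free_Abelian_group S) G h"
    by (intro F.generate_subgroup_incl h.subgroup_kernel)
  then obtain g where "g \<in> hom (presented_group S R) G"
    and g: "\<And>x. x \<in> carrier (free_Abelian_group S) \<Longrightarrow>
      g (generate (free_Abelian_group S) R #>\<^bsub>free_Abelian_group S\<^esub> x) = h x"
    using h.FactGroup_universal_kernel [OF presented_group_normal [OF R]]
    unfolding presented_group_def by blast
  then show thesis
    using that [of g] h(2) by (simp add: presented_class_def)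
qed

text \<open>
  The quotient map, packaged with the properties that turn a relation between generators into an
  equation between classes.
\<close>

lemma presented_group_quotient_map:
  assumes R: "R \<subseteq> carrier (free_Abelian_group S)"
  obtains h where "group_hom (free_Abelian_group S) (presented_group S R) h"
    "\<And>a. a \<in> S \<Longrightarrow> h (frag_of a) = presented_class S R a"
    "\<And>r. r \<in> R \<Longrightarrow> h r = \<one>\<^bsub>presented_group S R\<^esub>"
    "h ` carrier (free_Abelian_group S) = carrier (presented_group S R)"
proof -
  let ?F = "free_Abelian_group S" and ?N = "generate (free_Abelian_group S) R"
  interpret F: comm_group ?F by (rule abelian_free_Abelian_group)
  interpret N: normal ?N ?F by (rule presented_group_normal [OF R])
  interpret P: comm_group "presented_group S R" by (rule comm_group_presented_group [OF R])
  have "(\<lambda>a. ?N #>\<^bsub>?F\<^esub> a) \<in> hom ?F (presented_group S R)"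
    unfolding presented_group_def by (rule N.r_coset_hom_Mod)
  then have hom: "group_hom ?F (presented_group S R) (\<lambda>a. ?N #>\<^bsub>?F\<^esub> a)"
    by (simp add: group_hom_def group_hom_axioms_def P.is_group)
  have "?N #>\<^bsub>?F\<^esub> r = \<one>\<^bsub>presented_group S R\<^esub>" if "r \<in> R" for r
  proof -
    have "?N #>\<^bsub>?F\<^esub> r = ?N"
      by (rule F.coset_join2) (use that R in \<open>blast intro: generate.incl N.subgroup_axioms\<close>)+
    then show ?thesis
      by (simp add: presented_group_def FactGroup_def)
  qed
  moreover have "(\<lambda>a. ?N #>\<^bsub>?F\<^esub> a) ` carrier ?F = carrier (presented_group S R)"
    by (auto simp: presented_group_def FactGroup_def RCOSETS_def)
  ultimately show thesis
    using that [OF hom] by (simp add: presented_class_def)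
qed

lemma presented_group_hom_eq:
  assumes R: "R \<subseteq> carrier (free_Abelian_group S)" and G: "group G"
    and \<Phi>: "\<Phi> \<in> hom (presented_group S R) G" and \<Psi>: "\<Psi> \<in> hom (presented_group S R) G"
    and eq: "\<And>a. a \<in> S \<Longrightarrow> \<Phi> (presented_class S R a) = \<Psi> (presented_class S R a)"
    and x: "x \<in> carrier (presented_group S R)"
  shows "\<Phi> x = \<Psi> x"
proof -
  let ?F = "free_Abelian_group S"
  obtain h where h: "group_hom ?F (presented_group S R) h"
    "\<And>a. a \<in> S \<Longrightarrow> h (frag_of a) = presented_class S R a"
    "h ` carrier ?F = carrier (presented_group S R)"
    using presented_group_quotient_map [OF R] by metis
  interpret h: group_hom ?F "presented_group S R" h by (rule h(1))
  interpret \<Phi>: group_hom "presented_group S R" G \<Phi>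
    by (simp add: group_hom_def group_hom_axioms_def \<Phi> G)
  interpret \<Psi>: group_hom "presented_group S R" G \<Psi>
    by (simp add: group_hom_def group_hom_axioms_def \<Psi> G)
  obtain c where c: "c \<in> carrier ?F" "x = h c"
    using x h(3) by blast
  then have keys: "Poly_Mapping.keys c \<subseteq> S" by simp
  have "\<Phi> (h c) = \<Psi> (h c) \<and> c \<in> carrier ?F"
    using keys
  proof (induction rule: frag_induction)
    case zero
    then show ?case using h.hom_one by simp
  next
    case (one a)
    then show ?case using h(2) eq by simp
  next
    case (diff a b)
    then have "h (a - b) = h a \<otimes>\<^bsub>presented_group S R\<^esub> inv\<^bsub>presented_group S R\<^esub> h b"
      using h.hom_mult [of a "- b"] h.hom_inv [of b] by (simp add: keys_minus)
    then show ?case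
      using diff by (auto dest!: subsetD [OF keys_diff])
  qed
  then show ?thesis using c by simp
qed

section \<open>Zero morphisms and negatives\<close>

context category
begin

lemma Hom_Obj:
  assumes "f \<in> Hom \<C> A B"
  shows "A \<in> Obj \<C>" "B \<in> Obj \<C>"
  using assms Dom_Obj Cod_Obj by (auto simp: Hom_def)

lemma Hom_unique:
  assumes "f \<in> Hom \<C> A B" "f \<in> Hom \<C> A' B'"
  shows "A' = A" "B' = B"
  using assms by (auto simp: Hom_def)

lemma is_iso_arr_Ide: "A \<in> Obj \<C> \<Longrightarrow> is_iso_arr \<C> (Ide \<C> A)"
  unfolding is_iso_arr_def using Ide_Hom Comp_Ide by blast

lemma is_iso_arr_inverse:
  assumes "is_iso_arr \<C> f" "f \<in> Hom \<C> A B"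
  obtains g where "g \<in> Hom \<C> B A" "g \<cdot> f = Ide \<C> A" "f \<cdot> g = Ide \<C> B" "is_iso_arr \<C> g"
  using assms unfolding is_iso_arr_def by (metis Hom_unique)

lemma isomorphic_obj_refl: "A \<in> Obj \<C> \<Longrightarrow> isomorphic_obj \<C> A A"
  unfolding isomorphic_obj_def using Ide_Hom is_iso_arr_Ide by blast

end

context additive_category
begin

lemma Zero_Hom: "\<lbrakk>A \<in> Obj \<C>; B \<in> Obj \<C>\<rbrakk> \<Longrightarrow> Zero \<C> A B \<in> Hom \<C> A B"
  using comm_group.axioms(2) [OF Hom_comm_group] group.is_monoid monoid.one_closed
  by (fastforce simp: Hom_group_def)

lemma Add_Hom: "\<lbrakk>f \<in> Hom \<C> A B; g \<in> Hom \<C> A B\<rbrakk> \<Longrightarrow> Add \<C> f g \<in> Hom \<C> A B"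
  using monoid.m_closed [OF comm_monoid.axioms(1) [OF comm_group.axioms(1) [OF Hom_comm_group]], of A B f g]
  by (simp add: Hom_group_def Hom_Obj)

lemma Add_Zero:
  assumes "f \<in> Hom \<C> A B"
  shows "Add \<C> f (Zero \<C> A B) = f" "Add \<C> (Zero \<C> A B) f = f"
proof -
  interpret H: comm_group "Hom_group \<C> A B" by (intro Hom_comm_group Hom_Obj [OF assms])
  show "Add \<C> f (Zero \<C> A B) = f" "Add \<C> (Zero \<C> A B) f = f"
    using H.r_one [of f] H.l_one [of f] assms by (simp_all add: Hom_group_def)
qed

lemma Zero_unique:
  assumes "f \<in> Hom \<C> A B" "g \<in> Hom \<C> A B" "Add \<C> f g = f"
  shows "g = Zero \<C> A B"
proof -
  interpret H: comm_group "Hom_group \<C> A B" by (intro Hom_comm_group Hom_Obj [OF assms(1)])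
  show ?thesis
    using H.l_cancel_one [of f g] assms by (simp add: Hom_group_def)
qed

lemma Comp_Zero:
  assumes "g \<in> Hom \<C> B C" "A \<in> Obj \<C>"
  shows "g \<cdot> Zero \<C> A B = Zero \<C> A C"
proof -
  have Z: "Zero \<C> A B \<in> Hom \<C> A B" by (intro Zero_Hom Hom_Obj(1) [OF assms(1)] assms(2))
  then have "Add \<C> (g \<cdot> Zero \<C> A B) (g \<cdot> Zero \<C> A B) = g \<cdot> Zero \<C> A B"
    using Comp_Add [OF Z Z assms(1)] Add_Zero [OF Z] by simp
  then show ?thesis
    using Zero_unique Comp_Hom [OF Z assms(1)] by blast
qed

lemma Zero_Comp:
  assumes "f \<in> Hom \<C> A B" "C \<in> Obj \<C>"
  shows "Zero \<C> B C \<cdot> f = Zero \<C> A C"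
proof -
  have Z: "Zero \<C> B C \<in> Hom \<C> B C" by (intro Zero_Hom Hom_Obj(2) [OF assms(1)] assms(2))
  then have "Add \<C> (Zero \<C> B C \<cdot> f) (Zero \<C> B C \<cdot> f) = Zero \<C> B C \<cdot> f"
    using Add_Comp [OF assms(1) Z Z] Add_Zero [OF Z] by simp
  then show ?thesis
    using Zero_unique Comp_Hom [OF assms(1) Z] by blast
qed

lemma Neg_Hom: "f \<in> Hom \<C> A B \<Longrightarrow> Neg \<C> f \<in> Hom \<C> A B"
  and Add_Neg: "f \<in> Hom \<C> A B \<Longrightarrow> Add \<C> f (Neg \<C> f) = Zero \<C> A B"
proof -
  assume f: "f \<in> Hom \<C> A B"
  interpret H: comm_group "Hom_group \<C> A B" by (intro Hom_comm_group Hom_Obj [OF f])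
  have "Neg \<C> f = inv\<^bsub>Hom_group \<C> A B\<^esub> f" and "f \<in> carrier (Hom_group \<C> A B)"
    using f by (auto simp: Neg_def Hom_def Hom_group_def)
  then show "Neg \<C> f \<in> Hom \<C> A B" "Add \<C> f (Neg \<C> f) = Zero \<C> A B"
    using H.inv_closed H.r_inv by (auto simp: Hom_group_def)
qed

lemma Neg_unique:
  assumes "f \<in> Hom \<C> A B" "g \<in> Hom \<C> A B" "Add \<C> f g = Zero \<C> A B"
  shows "g = Neg \<C> f" "f = Neg \<C> g"
proof -
  interpret H: comm_group "Hom_group \<C> A B" by (intro Hom_comm_group Hom_Obj [OF assms(1)])
  have "Neg \<C> f = inv\<^bsub>Hom_group \<C> A B\<^esub> f" "Neg \<C> g = inv\<^bsub>Hom_group \<C> A B\<^esub> g"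
    and "f \<in> carrier (Hom_group \<C> A B)" "g \<in> carrier (Hom_group \<C> A B)"
    and "f \<otimes>\<^bsub>Hom_group \<C> A B\<^esub> g = \<one>\<^bsub>Hom_group \<C> A B\<^esub>"
    using assms by (auto simp: Neg_def Hom_def Hom_group_def)
  then show "g = Neg \<C> f" "f = Neg \<C> g"
    using H.inv_equality H.m_comm by metis+
qed

lemma Neg_Neg: "f \<in> Hom \<C> A B \<Longrightarrow> Neg \<C> (Neg \<C> f) = f"
  using Neg_unique(2) Neg_Hom Add_Neg by metis

lemma Neg_Zero: "\<lbrakk>A \<in> Obj \<C>; B \<in> Obj \<C>\<rbrakk> \<Longrightarrow> Neg \<C> (Zero \<C> A B) = Zero \<C> A B"
  by (metis Add_Zero(1) Neg_unique(1) Zero_Hom)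

lemma Neg_inject: "\<lbrakk>f \<in> Hom \<C> A B; g \<in> Hom \<C> A B; Neg \<C> f = Neg \<C> g\<rbrakk> \<Longrightarrow> f = g"
  by (metis Neg_Neg)

lemma Comp_Neg:
  assumes "f \<in> Hom \<C> A B" "g \<in> Hom \<C> B C"
  shows "g \<cdot> Neg \<C> f = Neg \<C> (g \<cdot> f)"
proof (rule Neg_unique(1))
  show "Add \<C> (g \<cdot> f) (g \<cdot> Neg \<C> f) = Zero \<C> A C"
    using assms by (metis Add_Neg Comp_Add Comp_Zero Hom_Obj(1) Neg_Hom)
qed (use assms in \<open>blast intro: Comp_Hom Neg_Hom\<close>)+

lemma Neg_Comp:
  assumes "f \<in> Hom \<C> A B" "g \<in> Hom \<C> B C"
  shows "Neg \<C> g \<cdot> f = Neg \<C> (g \<cdot> f)"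
proof (rule Neg_unique(1))
  show "Add \<C> (g \<cdot> f) (Neg \<C> g \<cdot> f) = Zero \<C> A C"
    using assms by (metis Add_Neg Add_Comp Zero_Comp Hom_Obj(2) Neg_Hom)
qed (use assms in \<open>blast intro: Comp_Hom Neg_Hom\<close>)+

lemma Add_Neg_eq_Zero:
  assumes "f \<in> Hom \<C> A B" "g \<in> Hom \<C> A B" "Add \<C> f (Neg \<C> g) = Zero \<C> A B"
  shows "f = g"
  using Neg_unique(2) [OF assms(1) Neg_Hom [OF assms(2)] assms(3)] Neg_Neg [OF assms(2)] by simp

lemma is_zero_obj_iff: "is_zero_obj \<C> Z \<longleftrightarrow> Z \<in> Obj \<C> \<and> Ide \<C> Z = Zero \<C> Z Z"
proof safe
  assume Z: "is_zero_obj \<C> Z"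
  then show "Z \<in> Obj \<C>" by (simp add: is_zero_obj_def)
  with Z show "Ide \<C> Z = Zero \<C> Z Z"
    using Ide_Hom by (auto simp: is_zero_obj_def)
next
  assume Z: "Z \<in> Obj \<C>" "Ide \<C> Z = Zero \<C> Z Z"
  have "f = Zero \<C> A Z" if "f \<in> Hom \<C> A Z" for f A
    using Ide_Comp [OF that] Zero_Comp [OF that Z(1)] Z(2) by simp
  moreover have "f = Zero \<C> Z A" if "f \<in> Hom \<C> Z A" for f A
    using Comp_Ide [OF that] Comp_Zero [OF that Z(1)] Z(2) by simp
  ultimately show "is_zero_obj \<C> Z"
    using Z Zero_Hom unfolding is_zero_obj_def by blast
qed

lemma is_direct_sum_Obj: "is_direct_sum \<C> A B S \<Longrightarrow> A \<in> Obj \<C> \<and> B \<in> Obj \<C> \<and> S \<in> Obj \<C>"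
  unfolding is_direct_sum_def using Hom_Obj by blast

lemma is_direct_sum_zero:
  assumes "is_zero_obj \<C> Z" "A \<in> Obj \<C>"
  shows "is_direct_sum \<C> Z A A"
proof -
  have Z: "Z \<in> Obj \<C>" "Ide \<C> Z = Zero \<C> Z Z"
    using assms is_zero_obj_iff by auto
  have z: "Zero \<C> Z A \<in> Hom \<C> Z A" "Zero \<C> A Z \<in> Hom \<C> A Z" "Ide \<C> A \<in> Hom \<C> A A"
    using Zero_Hom Ide_Hom Z assms by auto
  then have "Add \<C> (Zero \<C> Z A \<cdot> Zero \<C> A Z) (Ide \<C> A \<cdot> Ide \<C> A) = Ide \<C> A"
    using Comp_Zero Ide_Comp Add_Zero assms by metis
  moreover have "Zero \<C> A Z \<cdot> Zero \<C> Z A = Ide \<C> Z" "Ide \<C> A \<cdot> Ide \<C> A = Ide \<C> A"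
    "Zero \<C> A Z \<cdot> Ide \<C> A = Zero \<C> A Z" "Ide \<C> A \<cdot> Zero \<C> Z A = Zero \<C> Z A"
    using z Z Comp_Zero Zero_Comp Comp_Ide Ide_Comp by metis+
  ultimately show ?thesis
    using z unfolding is_direct_sum_def by blast
qed

end

section \<open>The suspension\<close>

context additive_category
begin

lemma is_direct_sum_unique:
  assumes "is_direct_sum \<C> A B S" "is_direct_sum \<C> A B T"
  obtains e where "e \<in> Hom \<C> S T" "is_iso_arr \<C> e"
proof -
  obtain i j p q where ij: "i \<in> Hom \<C> A S" "j \<in> Hom \<C> B S" "p \<in> Hom \<C> S A" "q \<in> Hom \<C> S B"
    and eqs: "p \<cdot> i = Ide \<C> A" "q \<cdot> j = Ide \<C> B" "p \<cdot> j = Zero \<C> B A" "q \<cdot> i = Zero \<C> A B"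
      "Add \<C> (i \<cdot> p) (j \<cdot> q) = Ide \<C> S"
    using assms(1) unfolding is_direct_sum_def by blast
  obtain k l r s where kl: "k \<in> Hom \<C> A T" "l \<in> Hom \<C> B T" "r \<in> Hom \<C> T A" "s \<in> Hom \<C> T B"
    and eqs': "r \<cdot> k = Ide \<C> A" "s \<cdot> l = Ide \<C> B" "r \<cdot> l = Zero \<C> B A" "s \<cdot> k = Zero \<C> A B"
      "Add \<C> (k \<cdot> r) (l \<cdot> s) = Ide \<C> T"
    using assms(2) unfolding is_direct_sum_def by blast
  have inverse: "Add \<C> (i \<cdot> r) (j \<cdot> s) \<cdot> Add \<C> (k \<cdot> p) (l \<cdot> q) = Add \<C> (i \<cdot> p) (j \<cdot> q)"
    if ij: "i \<in> Hom \<C> A S" "j \<in> Hom \<C> B S" "p \<in> Hom \<C> S A" "q \<in> Hom \<C> S B"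
      and kl: "k \<in> Hom \<C> A T" "l \<in> Hom \<C> B T" "r \<in> Hom \<C> T A" "s \<in> Hom \<C> T B"
      and eqs': "r \<cdot> k = Ide \<C> A" "s \<cdot> l = Ide \<C> B" "r \<cdot> l = Zero \<C> B A" "s \<cdot> k = Zero \<C> A B"
    for i j p q k l r s S T
  proof -
    let ?e = "Add \<C> (k \<cdot> p) (l \<cdot> q)"
    have e: "?e \<in> Hom \<C> S T" and kp: "k \<cdot> p \<in> Hom \<C> S T" and lq: "l \<cdot> q \<in> Hom \<C> S T"
      and ir: "i \<cdot> r \<in> Hom \<C> T S" and js: "j \<cdot> s \<in> Hom \<C> T S"
      using ij kl by (blast intro: Add_Hom Comp_Hom)+
    note o = Hom_Obj [OF ij(1)] Hom_Obj [OF ij(2)]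
    have "r \<cdot> ?e = Add \<C> ((r \<cdot> k) \<cdot> p) ((r \<cdot> l) \<cdot> q)"
      using Comp_Add [OF kp lq kl(3)] Comp_assoc [OF ij(3) kl(1,3)] Comp_assoc [OF ij(4) kl(2,3)] by simp
    then have r: "r \<cdot> ?e = p"
      using eqs' Ide_Comp [OF ij(3)] Zero_Comp [OF ij(4) o(1)] Add_Zero [OF ij(3)] by simp
    have "s \<cdot> ?e = Add \<C> ((s \<cdot> k) \<cdot> p) ((s \<cdot> l) \<cdot> q)"
      using Comp_Add [OF kp lq kl(4)] Comp_assoc [OF ij(3) kl(1,4)] Comp_assoc [OF ij(4) kl(2,4)] by simp
    then have s: "s \<cdot> ?e = q"
      using eqs' Ide_Comp [OF ij(4)] Zero_Comp [OF ij(3) o(3)] Add_Zero [OF ij(4)] by simp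
    show ?thesis
      using Add_Comp [OF e ir js] Comp_assoc [OF e kl(3) ij(1)] Comp_assoc [OF e kl(4) ij(2)] r s by simp
  qed
  let ?e = "Add \<C> (k \<cdot> p) (l \<cdot> q)" and ?d = "Add \<C> (i \<cdot> r) (j \<cdot> s)"
  have "?d \<cdot> ?e = Ide \<C> S" "?e \<cdot> ?d = Ide \<C> T"
    using inverse [OF ij kl eqs'(1-4)] inverse [OF kl ij eqs(1-4)] eqs(5) eqs'(5) by simp_all
  moreover have "?e \<in> Hom \<C> S T" "?d \<in> Hom \<C> T S"
    using ij kl by (blast intro: Add_Hom Comp_Hom)+
  ultimately show thesis
    using that unfolding is_iso_arr_def by blast
qed

end

context suspended_category
begin

lemma ShArr_Hom: "f \<in> Hom \<C> A B \<Longrightarrow> ShArr \<C> f \<in> Hom \<C> (Sh \<C> A) (Sh \<C> B)"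
  using ShArr_bij [of A B] Hom_Obj [of f A B] by (auto simp: bij_betw_def)

lemma ShArr_inject: "\<lbrakk>f \<in> Hom \<C> A B; g \<in> Hom \<C> A B; ShArr \<C> f = ShArr \<C> g\<rbrakk> \<Longrightarrow> f = g"
  using ShArr_bij [of A B] Hom_Obj [of f A B] by (auto simp: bij_betw_def inj_on_def)

lemma ShArr_full:
  assumes "A \<in> Obj \<C>" "B \<in> Obj \<C>" "g \<in> Hom \<C> (Sh \<C> A) (Sh \<C> B)"
  obtains f where "f \<in> Hom \<C> A B" "ShArr \<C> f = g"
proof -
  have "g \<in> ShArr \<C> ` Hom \<C> A B"
    using ShArr_bij [OF assms(1,2)] assms(3) by (simp add: bij_betw_def)
  then show thesis using that by auto
qed

lemma ShArr_Zero:
  assumes "A \<in> Obj \<C>" "B \<in> Obj \<C>"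
  shows "ShArr \<C> (Zero \<C> A B) = Zero \<C> (Sh \<C> A) (Sh \<C> B)"
proof -
  have Z: "Zero \<C> A B \<in> Hom \<C> A B" by (rule Zero_Hom [OF assms])
  show ?thesis
    using Zero_unique [OF ShArr_Hom [OF Z] ShArr_Hom [OF Z]] ShArr_Add [OF Z Z] Add_Zero [OF Z]
    by simp
qed

lemma Sh_zero_obj: "is_zero_obj \<C> Z \<Longrightarrow> is_zero_obj \<C> (Sh \<C> Z)"
  unfolding is_zero_obj_iff using ShArr_Ide ShArr_Zero Sh_Obj by metis

lemma Sh_direct_sum_iff:
  assumes "A \<in> Obj \<C>" "B \<in> Obj \<C>" "S \<in> Obj \<C>"
  shows "is_direct_sum \<C> (Sh \<C> A) (Sh \<C> B) (Sh \<C> S) \<longleftrightarrow> is_direct_sum \<C> A B S"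
proof -
  have Sh_eqs: "p \<cdot> i = Ide \<C> A \<and> q \<cdot> j = Ide \<C> B \<and> p \<cdot> j = Zero \<C> B A \<and> q \<cdot> i = Zero \<C> A B
      \<and> Add \<C> (i \<cdot> p) (j \<cdot> q) = Ide \<C> S \<longleftrightarrow>
    ShArr \<C> p \<cdot> ShArr \<C> i = Ide \<C> (Sh \<C> A) \<and> ShArr \<C> q \<cdot> ShArr \<C> j = Ide \<C> (Sh \<C> B) \<and>
    ShArr \<C> p \<cdot> ShArr \<C> j = Zero \<C> (Sh \<C> B) (Sh \<C> A) \<and>
    ShArr \<C> q \<cdot> ShArr \<C> i = Zero \<C> (Sh \<C> A) (Sh \<C> B) \<and>
    Add \<C> (ShArr \<C> i \<cdot> ShArr \<C> p) (ShArr \<C> j \<cdot> ShArr \<C> q) = Ide \<C> (Sh \<C> S)"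
    if "i \<in> Hom \<C> A S" "j \<in> Hom \<C> B S" "p \<in> Hom \<C> S A" "q \<in> Hom \<C> S B" for i j p q
  proof -
    note c = Comp_Hom [OF that(1,3)] Comp_Hom [OF that(2,4)] Comp_Hom [OF that(2,3)]
      Comp_Hom [OF that(1,4)] Comp_Hom [OF that(3,1)] Comp_Hom [OF that(4,2)]
    have "ShArr \<C> (Add \<C> (i \<cdot> p) (j \<cdot> q)) = Add \<C> (ShArr \<C> i \<cdot> ShArr \<C> p) (ShArr \<C> j \<cdot> ShArr \<C> q)"
      using ShArr_Add [OF c(5,6)] ShArr_Comp that by metis
    moreover have "x = Ide \<C> U \<longleftrightarrow> ShArr \<C> x = Ide \<C> (Sh \<C> U)" if "x \<in> Hom \<C> U U" for x U
      using ShArr_inject [OF that Ide_Hom] ShArr_Ide Hom_Obj(1) [OF that] by auto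
    moreover have "x = Zero \<C> U V \<longleftrightarrow> ShArr \<C> x = Zero \<C> (Sh \<C> U) (Sh \<C> V)" if "x \<in> Hom \<C> U V" for x U V
      using ShArr_inject [OF that Zero_Hom] ShArr_Zero Hom_Obj [OF that] by auto
    ultimately show ?thesis
      using c Add_Hom [OF c(5,6)] ShArr_Comp [OF that(1,3)] ShArr_Comp [OF that(2,4)]
        ShArr_Comp [OF that(2,3)] ShArr_Comp [OF that(1,4)] by simp
  qed
  show ?thesis
  proof
    assume "is_direct_sum \<C> A B S"
    then obtain i j p q where ij: "i \<in> Hom \<C> A S" "j \<in> Hom \<C> B S" "p \<in> Hom \<C> S A" "q \<in> Hom \<C> S B"
      and "p \<cdot> i = Ide \<C> A \<and> q \<cdot> j = Ide \<C> B \<and> p \<cdot> j = Zero \<C> B A \<and> q \<cdot> i = Zero \<C> A B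
        \<and> Add \<C> (i \<cdot> p) (j \<cdot> q) = Ide \<C> S"
      unfolding is_direct_sum_def by blast
    with Sh_eqs [OF ij] show "is_direct_sum \<C> (Sh \<C> A) (Sh \<C> B) (Sh \<C> S)"
      using ij [THEN ShArr_Hom] unfolding is_direct_sum_def by blast
  next
    assume "is_direct_sum \<C> (Sh \<C> A) (Sh \<C> B) (Sh \<C> S)"
    then obtain i' j' p' q' where ij': "i' \<in> Hom \<C> (Sh \<C> A) (Sh \<C> S)" "j' \<in> Hom \<C> (Sh \<C> B) (Sh \<C> S)"
        "p' \<in> Hom \<C> (Sh \<C> S) (Sh \<C> A)" "q' \<in> Hom \<C> (Sh \<C> S) (Sh \<C> B)"
      and eqs: "p' \<cdot> i' = Ide \<C> (Sh \<C> A) \<and> q' \<cdot> j' = Ide \<C> (Sh \<C> B) \<and>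
        p' \<cdot> j' = Zero \<C> (Sh \<C> B) (Sh \<C> A) \<and> q' \<cdot> i' = Zero \<C> (Sh \<C> A) (Sh \<C> B) \<and>
        Add \<C> (i' \<cdot> p') (j' \<cdot> q') = Ide \<C> (Sh \<C> S)"
      unfolding is_direct_sum_def by blast
    obtain i where i: "i \<in> Hom \<C> A S" "ShArr \<C> i = i'" using ShArr_full [OF assms(1,3) ij'(1)] .
    obtain j where j: "j \<in> Hom \<C> B S" "ShArr \<C> j = j'" using ShArr_full [OF assms(2,3) ij'(2)] .
    obtain p where p: "p \<in> Hom \<C> S A" "ShArr \<C> p = p'" using ShArr_full [OF assms(3,1) ij'(3)] .
    obtain q where q: "q \<in> Hom \<C> S B" "ShArr \<C> q = q'" using ShArr_full [OF assms(3,2) ij'(4)] .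
    show "is_direct_sum \<C> A B S"
      using Sh_eqs [OF i(1) j(1) p(1) q(1)] eqs i j p q unfolding is_direct_sum_def by blast
  qed
qed

lemma Sh_pow_Obj: "A \<in> Obj \<C> \<Longrightarrow> (Sh \<C> ^^ i) A \<in> Obj \<C>"
  by (induction i) (auto intro: Sh_Obj)

lemma Sh_pow_zero_obj: "is_zero_obj \<C> Z \<Longrightarrow> is_zero_obj \<C> ((Sh \<C> ^^ i) Z)"
  by (induction i) (auto intro: Sh_zero_obj)

lemma Sh_pow_direct_sum:
  assumes "is_direct_sum \<C> A B S"
  shows "is_direct_sum \<C> ((Sh \<C> ^^ i) A) ((Sh \<C> ^^ i) B) ((Sh \<C> ^^ i) S)"
  using assms by (induction i) (auto simp: Sh_direct_sum_iff Sh_pow_Obj is_direct_sum_Obj)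

end

section \<open>Triangles\<close>

context triangulated_category
begin

lemma Dist_rotate:
  "\<lbrakk>Dist \<C> f g h; f \<in> Hom \<C> A B; g \<in> Hom \<C> B C; h \<in> Hom \<C> C (Sh \<C> A)\<rbrakk>
    \<Longrightarrow> Dist \<C> g h (Neg \<C> (ShArr \<C> f))"
  using TR2 by blast

text \<open>
  The identity of \<open>A\<close> and \<open>f\<close> extend to a map from \<open>A \<rightarrow> A \<rightarrow> 0\<close>, so \<open>g f\<close> factors through \<open>0\<close>.
\<close>

lemma Dist_Comp_Zero:
  assumes "Dist \<C> f g h" "f \<in> Hom \<C> A B" "g \<in> Hom \<C> B C"
  shows "g \<cdot> f = Zero \<C> A C"
proof -
  obtain Z where Z: "is_zero_obj \<C> Z" using zero_obj_exists by blast
  have A: "A \<in> Obj \<C>" "Z \<in> Obj \<C>" using Hom_Obj assms Z by (auto simp: is_zero_obj_def)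
  have "Ide \<C> A \<in> Hom \<C> A A" "Zero \<C> A Z \<in> Hom \<C> A Z" "f \<cdot> Ide \<C> A = f \<cdot> Ide \<C> A"
    using A Ide_Hom Zero_Hom by auto
  then obtain c where "c \<in> Hom \<C> Z C" "c \<cdot> Zero \<C> A Z = g \<cdot> f"
    using TR3 [OF TR1_ide [OF A(1) Z] assms(1) _ _ assms(2,3) _ assms(2)] by blast
  then show ?thesis using Comp_Zero A by metis
qed

text \<open>
  Exactness of \<open>\<C>(X, -)\<close> at \<open>B\<close>. Since \<open>g y = 0\<close>, the maps \<open>y\<close> and \<open>0\<close> form a square from
  \<open>X \<rightarrow> 0\<close> to \<open>g\<close>; its completion to a map from the triangle \<open>X \<rightarrow> 0 \<rightarrow> X[1]\<close> to the rotated one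
  is the suspension of the lift.
\<close>

lemma Dist_lift:
  assumes D: "Dist \<C> f g h" and f: "f \<in> Hom \<C> A B" and g: "g \<in> Hom \<C> B C" and h: "h \<in> Hom \<C> C (Sh \<C> A)"
    and y: "y \<in> Hom \<C> X B" "g \<cdot> y = Zero \<C> X C"
  obtains z where "z \<in> Hom \<C> X A" "f \<cdot> z = y"
proof -
  obtain Z where Z: "is_zero_obj \<C> Z" using zero_obj_exists by blast
  have o: "X \<in> Obj \<C>" "Z \<in> Obj \<C>" "A \<in> Obj \<C>" "B \<in> Obj \<C>" "C \<in> Obj \<C>" "Sh \<C> X \<in> Obj \<C>"
    using Hom_Obj y f g Z Sh_Obj by (auto simp: is_zero_obj_def)
  let ?i = "Ide \<C> (Sh \<C> X)"
  note z = Zero_Hom [OF o(1,2)] Zero_Hom [OF o(2,6)] Zero_Hom [OF o(2,5)]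
  have DX: "Dist \<C> (Zero \<C> X Z) (Zero \<C> Z (Sh \<C> X)) (Neg \<C> (ShArr \<C> (Ide \<C> X)))"
    using Dist_rotate [OF TR1_ide [OF o(1) Z]] Ide_Hom z o by blast
  have DB: "Dist \<C> g h (Neg \<C> (ShArr \<C> f))"
    by (rule Dist_rotate [OF D f g h])
  have "Zero \<C> Z C \<cdot> Zero \<C> X Z = g \<cdot> y"
    using y(2) Comp_Zero z(3) o(1) by simp
  then obtain c where c: "c \<in> Hom \<C> (Sh \<C> X) (Sh \<C> A)"
    and "ShArr \<C> y \<cdot> Neg \<C> (ShArr \<C> (Ide \<C> X)) = Neg \<C> (ShArr \<C> f) \<cdot> c"
    using TR3 [OF DX DB z(1,2) g h y(1) z(3)] by blast
  moreover have i: "?i \<in> Hom \<C> (Sh \<C> X) (Sh \<C> X)" "ShArr \<C> (Ide \<C> X) = ?i"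
    using o Ide_Hom ShArr_Ide by auto
  ultimately have "Neg \<C> (ShArr \<C> y) = Neg \<C> (ShArr \<C> f \<cdot> c)"
    using Comp_Neg [OF i(1) ShArr_Hom [OF y(1)]] Neg_Comp [OF c ShArr_Hom [OF f]]
      Comp_Ide [OF ShArr_Hom [OF y(1)]] by simp
  then have eq: "ShArr \<C> y = ShArr \<C> f \<cdot> c"
    using Neg_inject [OF ShArr_Hom [OF y(1)] Comp_Hom [OF c ShArr_Hom [OF f]]] by blast
  obtain z where z: "z \<in> Hom \<C> X A" "ShArr \<C> z = c"
    using ShArr_full o c by blast
  then have "f \<cdot> z = y"
    using ShArr_inject [OF Comp_Hom [OF z(1) f] y(1)] ShArr_Comp [OF z(1) f] eq by simp
  then show thesis using that z by blast
qed

lemma Dist_lift_right: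
  assumes "Dist \<C> f g h" "f \<in> Hom \<C> A B" "g \<in> Hom \<C> B C" "h \<in> Hom \<C> C (Sh \<C> A)"
    and "y \<in> Hom \<C> X C" "h \<cdot> y = Zero \<C> X (Sh \<C> A)"
  obtains z where "z \<in> Hom \<C> X B" "g \<cdot> z = y"
  using Dist_lift [OF Dist_rotate [OF assms(1-4)] assms(3,4) Neg_Hom [OF ShArr_Hom [OF assms(2)]]]
    assms(5,6) that by blast

lemma Dist_Neg_ShArr:
  assumes "Dist \<C> f g h" "f \<in> Hom \<C> A B" "g \<in> Hom \<C> B C" "h \<in> Hom \<C> C (Sh \<C> A)"
  shows "Dist \<C> (Neg \<C> (ShArr \<C> f)) (Neg \<C> (ShArr \<C> g)) (Neg \<C> (ShArr \<C> h))"
  using assms Dist_rotate Neg_Hom ShArr_Hom by meson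

text \<open>
  The maps of the shifted triangle are the shifted maps up to sign. Only their ends are recorded,
  since the triangle serves to compare groups of maps of which the outer ones vanish.
\<close>

lemma Dist_Sh_pow:
  assumes "Dist \<C> f g h" "f \<in> Hom \<C> A B" "g \<in> Hom \<C> B C" "h \<in> Hom \<C> C (Sh \<C> A)"
  obtains f' g' h' where "Dist \<C> f' g' h'"
    "f' \<in> Hom \<C> ((Sh \<C> ^^ i) A) ((Sh \<C> ^^ i) B)" "g' \<in> Hom \<C> ((Sh \<C> ^^ i) B) ((Sh \<C> ^^ i) C)"
    "h' \<in> Hom \<C> ((Sh \<C> ^^ i) C) (Sh \<C> ((Sh \<C> ^^ i) A))"
proof -
  have "\<exists>f' g' h'. Dist \<C> f' g' h' \<and>
    f' \<in> Hom \<C> ((Sh \<C> ^^ i) A) ((Sh \<C> ^^ i) B) \<and> g' \<in> Hom \<C> ((Sh \<C> ^^ i) B) ((Sh \<C> ^^ i) C) \<and>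
    h' \<in> Hom \<C> ((Sh \<C> ^^ i) C) (Sh \<C> ((Sh \<C> ^^ i) A))"
  proof (induction i)
    case 0
    then show ?case using assms by auto
  next
    case (Suc i)
    then obtain f' g' h' where t: "Dist \<C> f' g' h'"
      "f' \<in> Hom \<C> ((Sh \<C> ^^ i) A) ((Sh \<C> ^^ i) B)" "g' \<in> Hom \<C> ((Sh \<C> ^^ i) B) ((Sh \<C> ^^ i) C)"
      "h' \<in> Hom \<C> ((Sh \<C> ^^ i) C) (Sh \<C> ((Sh \<C> ^^ i) A))"
      by blast
    show ?case
      using Dist_Neg_ShArr [OF t] Neg_Hom [OF ShArr_Hom [OF t(2)]] Neg_Hom [OF ShArr_Hom [OF t(3)]]
        Neg_Hom [OF ShArr_Hom [OF t(4)]] by auto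
  qed
  then show thesis using that by blast
qed

text \<open>
  The identity of \<open>C\<close> lifts to a section \<open>j\<close> of \<open>g\<close>, and \<open>id - j g\<close>, killed by \<open>g\<close>, factors through
  \<open>f\<close>; the factor \<open>p\<close> is a retraction because \<open>f\<close> is monic.
\<close>

lemma Dist_Zero_split:
  assumes D: "Dist \<C> f g (Zero \<C> C (Sh \<C> A))" and f: "f \<in> Hom \<C> A B" and g: "g \<in> Hom \<C> B C"
  shows "is_direct_sum \<C> A C B"
proof -
  have o: "A \<in> Obj \<C>" "B \<in> Obj \<C>" "C \<in> Obj \<C>" "Sh \<C> A \<in> Obj \<C>"
    using Hom_Obj f g Sh_Obj by auto
  note h = Zero_Hom [OF o(3,4)]
  obtain j where j: "j \<in> Hom \<C> C B" "g \<cdot> j = Ide \<C> C"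
    using Dist_lift_right [OF D f g h Ide_Hom [OF o(3)]] Zero_Comp [OF Ide_Hom [OF o(3)] o(4)] by blast
  \<comment> \<open>\<open>f\<close> is monic, since \<open>f[1] y[1] = 0\<close> makes \<open>y[1]\<close> factor through the zero connecting map.\<close>
  have mono: "y = y'" if y: "y \<in> Hom \<C> X A" "y' \<in> Hom \<C> X A" "f \<cdot> y = f \<cdot> y'" for X y y'
  proof -
    let ?d = "Add \<C> y (Neg \<C> y')"
    have d: "?d \<in> Hom \<C> X A" by (intro Add_Hom Neg_Hom y)
    have X: "X \<in> Obj \<C>" "Sh \<C> X \<in> Obj \<C>" using Hom_Obj y Sh_Obj by blast+
    have "f \<cdot> ?d = Zero \<C> X B"
      using Comp_Add [OF y(1) Neg_Hom [OF y(2)] f] Comp_Neg [OF y(2) f] y(3)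
        Add_Neg [OF Comp_Hom [OF y(2) f]] by simp
    then have "Neg \<C> (ShArr \<C> f) \<cdot> ShArr \<C> ?d = Zero \<C> (Sh \<C> X) (Sh \<C> B)"
      using Neg_Comp [OF ShArr_Hom [OF d] ShArr_Hom [OF f]]
      by (simp add: ShArr_Comp [OF d f, symmetric] ShArr_Zero Neg_Zero X o Sh_Obj)
    then obtain z where "z \<in> Hom \<C> (Sh \<C> X) C" "Zero \<C> C (Sh \<C> A) \<cdot> z = ShArr \<C> ?d"
      using Dist_lift_right [OF Dist_rotate [OF D f g h] g h Neg_Hom [OF ShArr_Hom [OF f]] ShArr_Hom [OF d]]
      by blast
    then have "ShArr \<C> ?d = ShArr \<C> (Zero \<C> X A)"
      using Zero_Comp o(4) ShArr_Zero X o by metis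
    then have "?d = Zero \<C> X A"
      using ShArr_inject d Zero_Hom X o by blast
    then show ?thesis using Add_Neg_eq_Zero y by blast
  qed
  have jg: "j \<cdot> g \<in> Hom \<C> B B" using Comp_Hom g j by blast
  let ?e = "Add \<C> (Ide \<C> B) (Neg \<C> (j \<cdot> g))"
  have e: "?e \<in> Hom \<C> B B" by (intro Add_Hom Neg_Hom jg Ide_Hom o)
  have gjg: "g \<cdot> (j \<cdot> g) = g"
    using Comp_assoc [OF g j(1) g] j(2) Ide_Comp [OF g] by simp
  have "g \<cdot> ?e = Zero \<C> B C"
    using Comp_Add [OF Ide_Hom [OF o(2)] Neg_Hom [OF jg] g] Comp_Neg [OF jg g] gjg Comp_Ide [OF g]
      Add_Neg [OF g] by simp
  then obtain p where p: "p \<in> Hom \<C> B A" "f \<cdot> p = ?e"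
    using Dist_lift [OF D f g h e] by blast
  have gf: "g \<cdot> f = Zero \<C> A C" by (rule Dist_Comp_Zero [OF D f g])
  have Ide_split: "Add \<C> (f \<cdot> p) (j \<cdot> g) = Ide \<C> B"
  proof -
    interpret H: comm_group "Hom_group \<C> B B" by (intro Hom_comm_group o)
    have "Add \<C> (Neg \<C> (j \<cdot> g)) (j \<cdot> g) = Zero \<C> B B"
      using H.m_comm [of "j \<cdot> g" "Neg \<C> (j \<cdot> g)"] Add_Neg [OF jg] Neg_Hom [OF jg] jg
      by (simp add: Hom_group_def)
    then show ?thesis
      using H.m_assoc [of "Ide \<C> B" "Neg \<C> (j \<cdot> g)" "j \<cdot> g"] Neg_Hom [OF jg] jg Ide_Hom [OF o(2)]
        Add_Zero(1) [OF Ide_Hom [OF o(2)]] p(2) by (simp add: Hom_group_def)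
  qed
  have "f \<cdot> (p \<cdot> f) = f \<cdot> Ide \<C> A"
  proof -
    have "f \<cdot> (p \<cdot> f) = ?e \<cdot> f" using Comp_assoc [OF f p(1) f] p(2) by simp
    also have "\<dots> = Add \<C> (Ide \<C> B \<cdot> f) (Neg \<C> (j \<cdot> (g \<cdot> f)))"
      using Add_Comp [OF f Ide_Hom [OF o(2)] Neg_Hom [OF jg]] Neg_Comp [OF f jg] Comp_assoc [OF f g j(1)]
      by simp
    also have "\<dots> = f \<cdot> Ide \<C> A"
      using gf Comp_Zero [OF j(1) o(1)] Neg_Zero [OF o(1,2)] Ide_Comp [OF f] Comp_Ide [OF f]
        Add_Zero [OF f] by simp
    finally show ?thesis .
  qed
  then have pf: "p \<cdot> f = Ide \<C> A"
    using mono [OF Comp_Hom [OF f p(1)] Ide_Hom [OF o(1)]] by simp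
  have "f \<cdot> (p \<cdot> j) = f \<cdot> Zero \<C> C A"
  proof -
    have "f \<cdot> (p \<cdot> j) = ?e \<cdot> j" using Comp_assoc [OF j(1) p(1) f] p(2) by simp
    also have "\<dots> = Add \<C> (Ide \<C> B \<cdot> j) (Neg \<C> (j \<cdot> (g \<cdot> j)))"
      using Add_Comp [OF j(1) Ide_Hom [OF o(2)] Neg_Hom [OF jg]] Neg_Comp [OF j(1) jg]
        Comp_assoc [OF j(1) g j(1)] by simp
    also have "\<dots> = Zero \<C> C B"
      using j(2) Ide_Comp [OF j(1)] Comp_Ide [OF j(1)] Add_Neg [OF j(1)] by simp
    finally show ?thesis using Comp_Zero [OF f o(3)] by simp
  qed
  then have pj: "p \<cdot> j = Zero \<C> C A"
    using mono [OF Comp_Hom [OF j(1) p(1)] Zero_Hom [OF o(3,1)]] by simp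
  show ?thesis
    using f g j p(1) pf pj gf Ide_split unfolding is_direct_sum_def by blast
qed

text \<open>
  The cone of \<open>g\<close> is isomorphic to a suspension, and the suspension is full, so the triangle on \<open>g\<close>
  can be rotated back.
\<close>

lemma Dist_cocone:
  assumes g: "g \<in> Hom \<C> B C"
  obtains A f h where "f \<in> Hom \<C> A B" "h \<in> Hom \<C> C (Sh \<C> A)" "Dist \<C> f g h"
proof -
  have o: "B \<in> Obj \<C>" "C \<in> Obj \<C>" using Hom_Obj [OF g] .
  have "g \<in> Arr \<C>" using g by (simp add: Hom_def)
  then obtain q v where D: "Dist \<C> g q v" using TR1_cone by blast
  then obtain Q where q: "q \<in> Hom \<C> C Q" and v: "v \<in> Hom \<C> Q (Sh \<C> B)"
    using Dist_Hom Hom_unique [OF g] by metis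
  obtain A d where A: "A \<in> Obj \<C>" and d: "d \<in> Hom \<C> (Sh \<C> A) Q" "is_iso_arr \<C> d"
    using Sh_ess_surj [OF Hom_Obj(2) [OF q]] unfolding isomorphic_obj_def by blast
  obtain e where e: "e \<in> Hom \<C> Q (Sh \<C> A)" "d \<cdot> e = Ide \<C> Q" "is_iso_arr \<C> e"
    using is_iso_arr_inverse [OF d(2,1)] by blast
  have eq: "e \<cdot> q \<in> Hom \<C> C (Sh \<C> A)" and vd: "v \<cdot> d \<in> Hom \<C> (Sh \<C> A) (Sh \<C> B)"
    using Comp_Hom q v d e by blast+
  have D': "Dist \<C> g (e \<cdot> q) (v \<cdot> d)"
  proof (rule TR1_iso [OF D g q v g eq vd Ide_Hom [OF o(1)] Ide_Hom [OF o(2)] e(1)])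
    show "Ide \<C> C \<cdot> g = g \<cdot> Ide \<C> B"
      using Ide_Comp Comp_Ide g by simp
    show "e \<cdot> q = (e \<cdot> q) \<cdot> Ide \<C> C"
      using Comp_Ide eq by simp
    show "ShArr \<C> (Ide \<C> B) \<cdot> v = (v \<cdot> d) \<cdot> e"
      using ShArr_Ide [OF o(1)] Ide_Comp [OF v] Comp_Ide [OF v] Comp_assoc [OF e(1) d(1) v] e(2) by simp
  qed (use is_iso_arr_Ide o e in auto)
  obtain f where f: "f \<in> Hom \<C> A B" "ShArr \<C> f = Neg \<C> (v \<cdot> d)"
    using ShArr_full [OF A o(1) Neg_Hom [OF vd]] .
  have "Dist \<C> f g (e \<cdot> q)"
    using TR2 [OF f(1) g eq] D' f(2) Neg_Neg [OF vd] by simp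
  then show thesis using that [OF f(1) eq] by blast
qed

text \<open>
  The homotopy pullback of \<open>g\<close> along \<open>x\<close>. Since \<open>h x = 0\<close>, the map \<open>x\<close> lifts along \<open>g\<close>, and the
  pullback is \<open>A \<oplus> X\<close>; the octahedral axiom for the composite \<open>k g\<close> of \<open>g\<close> with the connecting map
  of the second triangle gives its suspension as an extension of \<open>X[1]\<close> by \<open>A[1]\<close> with connecting
  map \<open>\<plusminus> (h x)[1]\<close>.
\<close>

lemma Dist_pullback:
  assumes D: "Dist \<C> f g h" and f: "f \<in> Hom \<C> A B" and g: "g \<in> Hom \<C> B C" and h: "h \<in> Hom \<C> C (Sh \<C> A)"
    and E: "Dist \<C> u x k" and u: "u \<in> Hom \<C> K X" and x: "x \<in> Hom \<C> X C" and k: "k \<in> Hom \<C> C (Sh \<C> K)"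
    and hx: "h \<cdot> x = Zero \<C> X (Sh \<C> A)"
  obtains W a b where "is_direct_sum \<C> A X W" "a \<in> Hom \<C> K W" "b \<in> Hom \<C> W B" "Dist \<C> a b (k \<cdot> g)"
proof -
  have o: "A \<in> Obj \<C>" "X \<in> Obj \<C>" "K \<in> Obj \<C>" using f u Hom_Obj by blast+
  have kg: "k \<cdot> g \<in> Hom \<C> B (Sh \<C> K)" using Comp_Hom g k by blast
  have ShK: "Sh \<C> K \<in> Obj \<C>" by (rule Hom_Obj(2) [OF k])
  \<comment> \<open>Rotating the cocone \<open>W\<close> of \<open>k g\<close> makes \<open>W[1]\<close> the cone of \<open>k g\<close>.\<close>
  obtain W b q where b: "b \<in> Hom \<C> W B" and q: "q \<in> Hom \<C> (Sh \<C> K) (Sh \<C> W)" and Db: "Dist \<C> b (k \<cdot> g) q"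
    using Dist_cocone [OF kg] .
  have W: "W \<in> Obj \<C>" by (rule Hom_Obj(1) [OF b])
  have D': "Dist \<C> (k \<cdot> g) q (Neg \<C> (ShArr \<C> b))"
    by (rule Dist_rotate [OF Db b kg q])
  obtain a where a: "a \<in> Hom \<C> K W" "ShArr \<C> a = Neg \<C> q"
    using ShArr_full [OF o(3) W Neg_Hom [OF q]] .
  have Dab: "Dist \<C> a b (k \<cdot> g)"
    using TR2 [OF a(1) b kg] Db a(2) Neg_Neg [OF q] by simp
  have nf: "Neg \<C> (ShArr \<C> f) \<in> Hom \<C> (Sh \<C> A) (Sh \<C> B)" using Neg_Hom ShArr_Hom f by blast
  have nu: "Neg \<C> (ShArr \<C> u) \<in> Hom \<C> (Sh \<C> K) (Sh \<C> X)" using Neg_Hom ShArr_Hom u by blast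
  have Dg: "Dist \<C> g h (Neg \<C> (ShArr \<C> f))" by (rule Dist_rotate [OF D f g h])
  have Dk: "Dist \<C> k (Neg \<C> (ShArr \<C> u)) (Neg \<C> (ShArr \<C> x))"
    by (rule Dist_rotate [OF Dist_rotate [OF E u x k] x k nu])
  obtain s t where s: "s \<in> Hom \<C> (Sh \<C> A) (Sh \<C> W)" and t: "t \<in> Hom \<C> (Sh \<C> W) (Sh \<C> X)"
    and Dst: "Dist \<C> s t (ShArr \<C> h \<cdot> Neg \<C> (ShArr \<C> x))"
    using TR4 [OF g k Dg h D' q Dk nu] by blast
  have "ShArr \<C> h \<cdot> Neg \<C> (ShArr \<C> x) = Zero \<C> (Sh \<C> X) (Sh \<C> (Sh \<C> A))"
    using Comp_Neg [OF ShArr_Hom [OF x] ShArr_Hom [OF h]] hx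
    by (simp add: ShArr_Comp [OF x h, symmetric] ShArr_Zero Neg_Zero Sh_Obj o)
  then have "is_direct_sum \<C> (Sh \<C> A) (Sh \<C> X) (Sh \<C> W)"
    using Dist_Zero_split Dst s t by simp
  then have "is_direct_sum \<C> A X W"
    using Sh_direct_sum_iff o W by blast
  then show thesis using that a(1) b Dab by blast
qed

text \<open>
  The pullback of \<open>A \<rightarrow> 0\<close> along \<open>X \<rightarrow> 0\<close> is a direct sum of \<open>A\<close> and \<open>X\<close>, hence isomorphic to \<open>S\<close>,
  and its triangle is carried over to \<open>S\<close>.
\<close>

lemma Dist_direct_sum:
  assumes sum: "is_direct_sum \<C> A X S"
  obtains a b where "a \<in> Hom \<C> X S" "b \<in> Hom \<C> S A" "Dist \<C> a b (Zero \<C> A (Sh \<C> X))"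
proof -
  obtain Z where Z: "is_zero_obj \<C> Z" using zero_obj_exists by blast
  have o: "A \<in> Obj \<C>" "X \<in> Obj \<C>" "S \<in> Obj \<C>" "Z \<in> Obj \<C>" "Sh \<C> A \<in> Obj \<C>" "Sh \<C> X \<in> Obj \<C>"
    using is_direct_sum_Obj [OF sum] Z Sh_Obj by (auto simp: is_zero_obj_def)
  note zs = Zero_Hom [OF o(1,4)] Zero_Hom [OF o(4,5)] Zero_Hom [OF o(2,4)] Zero_Hom [OF o(4,6)]
  have "Zero \<C> Z (Sh \<C> A) \<cdot> Zero \<C> X Z = Zero \<C> X (Sh \<C> A)"
    using Zero_Comp [OF zs(3) o(5)] .
  then obtain W a b where W: "is_direct_sum \<C> A X W" and a: "a \<in> Hom \<C> X W" and b: "b \<in> Hom \<C> W A"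
    and D: "Dist \<C> a b (Zero \<C> Z (Sh \<C> X) \<cdot> Zero \<C> A Z)"
    using Dist_pullback [OF TR1_ide [OF o(1) Z] Ide_Hom [OF o(1)] zs(1,2)
        TR1_ide [OF o(2) Z] Ide_Hom [OF o(2)] zs(3,4)] by blast
  have D0: "Dist \<C> a b (Zero \<C> A (Sh \<C> X))"
    using D Zero_Comp [OF zs(1) o(6)] by simp
  obtain e where e: "e \<in> Hom \<C> W S" "is_iso_arr \<C> e"
    using is_direct_sum_unique [OF W sum] .
  obtain d where d: "d \<in> Hom \<C> S W" "d \<cdot> e = Ide \<C> W"
    using is_iso_arr_inverse [OF e(2,1)] by blast
  note z = Zero_Hom [OF o(1,6)]
  have ea: "e \<cdot> a \<in> Hom \<C> X S" and bd: "b \<cdot> d \<in> Hom \<C> S A"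
    using Comp_Hom a b d e by blast+
  have "Dist \<C> (e \<cdot> a) (b \<cdot> d) (Zero \<C> A (Sh \<C> X))"
  proof (rule TR1_iso [OF D0 a b z ea bd z Ide_Hom [OF o(2)] e(1) Ide_Hom [OF o(1)]])
    show "e \<cdot> a = (e \<cdot> a) \<cdot> Ide \<C> X"
      using Comp_Ide [OF ea] by simp
    show "Ide \<C> A \<cdot> b = (b \<cdot> d) \<cdot> e"
      using Ide_Comp [OF b] Comp_Ide [OF b] Comp_assoc [OF e(1) d(1) b] d(2) by simp
    show "ShArr \<C> (Ide \<C> X) \<cdot> Zero \<C> A (Sh \<C> X) = Zero \<C> A (Sh \<C> X) \<cdot> Ide \<C> A"
      using ShArr_Ide [OF o(2)] Ide_Comp [OF z] Comp_Ide [OF z] by simp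
  qed (use is_iso_arr_Ide o e in auto)
  then show thesis using that ea bd by blast
qed

end

section \<open>Resolutions and their index\<close>

lemma (in comm_group) sum_of_differences:
  assumes "b \<otimes> (xc \<otimes> xa) = a \<otimes> (c \<otimes> xb)"
    and [simp]: "a \<in> carrier G" "b \<in> carrier G" "c \<in> carrier G"
      "xa \<in> carrier G" "xb \<in> carrier G" "xc \<in> carrier G"
  shows "xb \<otimes> inv b = (xa \<otimes> inv a) \<otimes> (xc \<otimes> inv c)"
proof -
  have "xb = (b \<otimes> (xc \<otimes> xa)) \<otimes> inv (a \<otimes> c)"
    using assms(1) by (subst inv_solve_right) (simp_all add: m_ac)
  also have "\<dots> = ((xa \<otimes> inv a) \<otimes> (xc \<otimes> inv c)) \<otimes> b"
    by (simp add: inv_mult m_ac)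
  finally show ?thesis
    by (subst eq_commute) (simp add: inv_solve_right)
qed

text \<open>
  Independence of resolutions, additivity of the index and the comparison of the Grothendieck groups
  are arguments about relative projectives, so they are made for every full subcategory that is
  closed under finite direct sums.
\<close>

locale additive_subcategory = triangulated_category \<C>
  for \<C> :: "('o, 'm, 'z) triangulated_category_scheme" (structure) and \<X> :: "'o set" +
  assumes subcategory_Obj: "\<X> \<subseteq> Obj \<C>"
    and zero_mem: "is_zero_obj \<C> Z \<Longrightarrow> Z \<in> \<X>"
    and direct_sum_mem: "\<lbrakk>X \<in> \<X>; Y \<in> \<X>; is_direct_sum \<C> X Y S\<rbrakk> \<Longrightarrow> S \<in> \<X>"
begin

abbreviation conflation :: "'o \<Rightarrow> 'm \<Rightarrow> 'o \<Rightarrow> 'm \<Rightarrow> 'o \<Rightarrow> bool"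
  where "conflation \<equiv> rel_conflation \<C> \<X>"

lemma mem_Obj: "X \<in> \<X> \<Longrightarrow> X \<in> Obj \<C>"
  using subcategory_Obj by blast

lemma conflation_Obj:
  assumes "conflation A f B g C"
  shows "A \<in> Obj \<C>" "B \<in> Obj \<C>" "C \<in> Obj \<C>"
  using assms Hom_Obj unfolding rel_conflation_def by blast+

lemma conflationE:
  assumes "conflation A f B g C"
  obtains h where "Dist \<C> f g h" "f \<in> Hom \<C> A B" "g \<in> Hom \<C> B C" "h \<in> Hom \<C> C (Sh \<C> A)"
    "\<And>X x. \<lbrakk>X \<in> \<X>; x \<in> Hom \<C> X C\<rbrakk> \<Longrightarrow> h \<cdot> x = Zero \<C> X (Sh \<C> A)"
  using assms unfolding rel_conflation_def rel_ext_def by blast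

lemma conflationI:
  assumes "Dist \<C> f g h" "f \<in> Hom \<C> A B" "g \<in> Hom \<C> B C" "h \<in> Hom \<C> C (Sh \<C> A)"
    and "\<And>X x. \<lbrakk>X \<in> \<X>; x \<in> Hom \<C> X C\<rbrakk> \<Longrightarrow> h \<cdot> x = Zero \<C> X (Sh \<C> A)"
  shows "conflation A f B g C"
  using assms unfolding rel_conflation_def rel_ext_def by blast

text \<open>
  Conflations \<open>A \<rightarrow> B \<rightarrow> 0\<close> make invariance under isomorphism a case of additivity.
\<close>

lemma conflation_isomorphic:
  assumes iso: "isomorphic_obj \<C> A B" and Z: "is_zero_obj \<C> Z"
  obtains f g where "conflation A f B g Z"
proof -
  obtain e where e: "e \<in> Hom \<C> A B" "is_iso_arr \<C> e"
    using iso unfolding isomorphic_obj_def by blast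
  have o: "A \<in> Obj \<C>" "B \<in> Obj \<C>" "Z \<in> Obj \<C>" "Sh \<C> A \<in> Obj \<C>"
    using Hom_Obj [OF e(1)] Z Sh_Obj by (auto simp: is_zero_obj_def)
  obtain d where d: "d \<in> Hom \<C> B A" "d \<cdot> e = Ide \<C> A"
    using is_iso_arr_inverse [OF e(2,1)] by blast
  note z = Zero_Hom [OF o(1,3)] Zero_Hom [OF o(3,4)] Zero_Hom [OF o(2,3)]
  have "Dist \<C> e (Zero \<C> B Z) (Zero \<C> Z (Sh \<C> A))"
  proof (rule TR1_iso [OF TR1_ide [OF o(1) Z] Ide_Hom [OF o(1)] z(1,2) e(1) z(3,2)
        Ide_Hom [OF o(1)] e(1) Ide_Hom [OF o(3)]])
    show "Ide \<C> Z \<cdot> Zero \<C> A Z = Zero \<C> B Z \<cdot> e"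
      using Ide_Comp [OF z(1)] Zero_Comp [OF e(1) o(3)] by simp
    show "ShArr \<C> (Ide \<C> A) \<cdot> Zero \<C> Z (Sh \<C> A) = Zero \<C> Z (Sh \<C> A) \<cdot> Ide \<C> Z"
      using ShArr_Ide [OF o(1)] Ide_Comp [OF z(2)] Comp_Ide [OF z(2)] by simp
  qed (use is_iso_arr_Ide o e in auto)
  then have "conflation A e B (Zero \<C> B Z) Z"
    using conflationI [OF _ e(1) z(3,2)] Zero_Comp o by blast
  then show thesis using that by blast
qed

lemma conflation_direct_sum:
  assumes "is_direct_sum \<C> A X S"
  obtains f g where "conflation X f S g A"
proof -
  have o: "A \<in> Obj \<C>" "Sh \<C> X \<in> Obj \<C>"
    using is_direct_sum_Obj [OF assms] Sh_Obj by auto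
  obtain a b where "a \<in> Hom \<C> X S" "b \<in> Hom \<C> S A" "Dist \<C> a b (Zero \<C> A (Sh \<C> X))"
    using Dist_direct_sum [OF assms] .
  then have "conflation X a S b A"
    using conflationI Zero_Hom Zero_Comp o by blast
  then show thesis using that by blast
qed

text \<open>
  The connecting map of the new triangle is that of \<open>K \<rightarrow> X \<rightarrow> C\<close> composed with \<open>B \<rightarrow> C\<close>, hence
  again vanishes on maps from \<open>\<X>\<close>.
\<close>

lemma conflation_pullback:
  assumes c: "conflation A f B g C" and r: "conflation K u X x C" and X: "X \<in> \<X>"
  obtains W a b where "is_direct_sum \<C> A X W" "conflation K a W b B"
proof -
  obtain h where h: "Dist \<C> f g h" "f \<in> Hom \<C> A B" "g \<in> Hom \<C> B C" "h \<in> Hom \<C> C (Sh \<C> A)"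
    and hx: "\<And>X x. \<lbrakk>X \<in> \<X>; x \<in> Hom \<C> X C\<rbrakk> \<Longrightarrow> h \<cdot> x = Zero \<C> X (Sh \<C> A)"
    using conflationE [OF c] by blast
  obtain k where k: "Dist \<C> u x k" "u \<in> Hom \<C> K X" "x \<in> Hom \<C> X C" "k \<in> Hom \<C> C (Sh \<C> K)"
    and kx: "\<And>X x. \<lbrakk>X \<in> \<X>; x \<in> Hom \<C> X C\<rbrakk> \<Longrightarrow> k \<cdot> x = Zero \<C> X (Sh \<C> K)"
    using conflationE [OF r] by blast
  obtain W a b where W: "is_direct_sum \<C> A X W" and ab: "a \<in> Hom \<C> K W" "b \<in> Hom \<C> W B"
    and D: "Dist \<C> a b (k \<cdot> g)"
    using Dist_pullback [OF h k hx [OF X k(3)]] .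
  have "(k \<cdot> g) \<cdot> y = Zero \<C> Y (Sh \<C> K)" if y: "Y \<in> \<X>" "y \<in> Hom \<C> Y B" for Y y
    using Comp_assoc [OF y(2) h(3) k(4)] kx [OF y(1) Comp_Hom [OF y(2) h(3)]] by simp
  then have "conflation K a W b B"
    by (rule conflationI [OF D ab Comp_Hom [OF h(3) k(4)]])
  then show thesis using that W by blast
qed

text \<open>Objects of \<open>\<X>\<close> are projective: an extension \<open>h\<close> of such an object is \<open>h id = 0\<close>.\<close>

lemma conflation_split:
  assumes c: "conflation A f B g C" and C: "C \<in> \<X>"
  shows "is_direct_sum \<C> A C B"
proof -
  obtain h where h: "Dist \<C> f g h" "f \<in> Hom \<C> A B" "g \<in> Hom \<C> B C" "h \<in> Hom \<C> C (Sh \<C> A)"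
    and hx: "\<And>X x. \<lbrakk>X \<in> \<X>; x \<in> Hom \<C> X C\<rbrakk> \<Longrightarrow> h \<cdot> x = Zero \<C> X (Sh \<C> A)"
    using conflationE [OF c] by blast
  have "h = Zero \<C> C (Sh \<C> A)"
    using hx [OF C Ide_Hom [OF mem_Obj [OF C]]] Comp_Ide [OF h(4)] by simp
  then show ?thesis using Dist_Zero_split h by blast
qed

lemma K0_split_relations_carrier:
  "K0_split_relations \<C> \<X> \<subseteq> carrier (free_Abelian_group (iso_class \<C> \<X> ` \<X>))"
  unfolding K0_split_relations_def
  by (auto dest!: subsetD [OF keys_diff] subsetD [OF keys_add] split: if_splits)

lemma K0_rel_relations_carrier:
  "K0_rel_relations \<C> \<X> \<subseteq> carrier (free_Abelian_group (iso_class \<C> (Obj \<C>) ` Obj \<C>))"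
proof
  fix r assume "r \<in> K0_rel_relations \<C> \<X>"
  then obtain A f B g C where c: "conflation A f B g C"
    and r: "r = frag_of (iso_class \<C> (Obj \<C>) A) - frag_of (iso_class \<C> (Obj \<C>) B)
      + frag_of (iso_class \<C> (Obj \<C>) C)"
    unfolding K0_rel_relations_def by blast
  show "r \<in> carrier (free_Abelian_group (iso_class \<C> (Obj \<C>) ` Obj \<C>))"
    unfolding r using conflation_Obj [OF c]
    by (auto dest!: subsetD [OF keys_diff] subsetD [OF keys_add] split: if_splits)
qed

lemma K0_split_class_carrier: "X \<in> \<X> \<Longrightarrow> K0_split_class \<C> \<X> X \<in> carrier (K0_split \<C> \<X>)"
  unfolding K0_split_class_def K0_split_def by (intro presented_class_carrier imageI)

lemma K0_rel_class_carrier: "C \<in> Obj \<C> \<Longrightarrow> K0_rel_class \<C> \<X> C \<in> carrier (K0_rel \<C> \<X>)"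
  unfolding K0_rel_class_def K0_rel_def by (intro presented_class_carrier imageI)

lemma K0_split_class_direct_sum:
  assumes X: "X \<in> \<X>" "Y \<in> \<X>" and sum: "is_direct_sum \<C> X Y S"
  shows "K0_split_class \<C> \<X> S = K0_split_class \<C> \<X> X \<otimes>\<^bsub>K0_split \<C> \<X>\<^esub> K0_split_class \<C> \<X> Y"
proof -
  let ?F = "free_Abelian_group (iso_class \<C> \<X> ` \<X>)"
  have S: "S \<in> \<X>" using direct_sum_mem X sum by blast
  obtain h where "group_hom ?F (K0_split \<C> \<X>) h"
    and frag: "\<And>U. U \<in> \<X> \<Longrightarrow> h (frag_of (iso_class \<C> \<X> U)) = K0_split_class \<C> \<X> U"
    and rel: "\<And>r. r \<in> K0_split_relations \<C> \<X> \<Longrightarrow> h r = \<one>\<^bsub>K0_split \<C> \<X>\<^esub>"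
    using presented_group_quotient_map [OF K0_split_relations_carrier]
    unfolding K0_split_def K0_split_class_def by (metis imageI)
  then interpret h: group_hom ?F "K0_split \<C> \<X>" h by simp
  let ?s = "frag_of (iso_class \<C> \<X> S)"
  let ?xy = "frag_of (iso_class \<C> \<X> X) + frag_of (iso_class \<C> \<X> Y)"
  have carr: "?s - ?xy \<in> carrier ?F" "?xy \<in> carrier ?F" "frag_of (iso_class \<C> \<X> X) \<in> carrier ?F"
    "frag_of (iso_class \<C> \<X> Y) \<in> carrier ?F"
    using X S by (auto dest!: subsetD [OF keys_diff] subsetD [OF keys_add] split: if_splits)
  have "h (?s - ?xy) = \<one>\<^bsub>K0_split \<C> \<X>\<^esub>"
    using X S sum by (intro rel) (auto simp: K0_split_relations_def)
  then have "h ?s = h ?xy"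
    using h.hom_mult [OF carr(1,2)] h.hom_closed [OF carr(2)] by simp
  also have "\<dots> = h (frag_of (iso_class \<C> \<X> X)) \<otimes>\<^bsub>K0_split \<C> \<X>\<^esub> h (frag_of (iso_class \<C> \<X> Y))"
    using h.hom_mult [OF carr(3,4)] by simp
  finally show ?thesis using frag X S by simp
qed

lemma K0_rel_class_conflation:
  assumes c: "conflation A f B g C"
  shows "K0_rel_class \<C> \<X> B = K0_rel_class \<C> \<X> A \<otimes>\<^bsub>K0_rel \<C> \<X>\<^esub> K0_rel_class \<C> \<X> C"
proof -
  let ?F = "free_Abelian_group (iso_class \<C> (Obj \<C>) ` Obj \<C>)"
  let ?a = "frag_of (iso_class \<C> (Obj \<C>) A)" and ?b = "frag_of (iso_class \<C> (Obj \<C>) B)"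
    and ?c = "frag_of (iso_class \<C> (Obj \<C>) C)"
  note o = conflation_Obj [OF c]
  obtain h where "group_hom ?F (K0_rel \<C> \<X>) h"
    and frag: "\<And>U. U \<in> Obj \<C> \<Longrightarrow> h (frag_of (iso_class \<C> (Obj \<C>) U)) = K0_rel_class \<C> \<X> U"
    and rel: "\<And>r. r \<in> K0_rel_relations \<C> \<X> \<Longrightarrow> h r = \<one>\<^bsub>K0_rel \<C> \<X>\<^esub>"
    using presented_group_quotient_map [OF K0_rel_relations_carrier]
    unfolding K0_rel_def K0_rel_class_def by (metis imageI)
  then interpret h: group_hom ?F "K0_rel \<C> \<X>" h by simp
  have r: "?a - ?b + ?c \<in> K0_rel_relations \<C> \<X>"
    using c unfolding K0_rel_relations_def by blast
  have carr: "?a - ?b + ?c \<in> carrier ?F" "?a \<in> carrier ?F" "?b \<in> carrier ?F" "?c \<in> carrier ?F"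
    using o subsetD [OF K0_rel_relations_carrier r] by simp_all
  have "h (?a - ?b + ?c) \<otimes>\<^bsub>K0_rel \<C> \<X>\<^esub> h ?b = h (?a + ?c)"
    using h.hom_mult [OF carr(1,3)] by (simp add: algebra_simps)
  also have "\<dots> = h ?a \<otimes>\<^bsub>K0_rel \<C> \<X>\<^esub> h ?c"
    using h.hom_mult [OF carr(2,4)] by simp
  finally show ?thesis
    using rel [OF r] frag o h.hom_closed [OF carr(3)] by simp
qed

lemma K0_rel_class_zero:
  assumes Z: "is_zero_obj \<C> Z"
  shows "K0_rel_class \<C> \<X> Z = \<one>\<^bsub>K0_rel \<C> \<X>\<^esub>"
proof -
  interpret R: comm_group "K0_rel \<C> \<X>" by (rule comm_group_K0_rel)
  have o: "Z \<in> Obj \<C>" using Z by (simp add: is_zero_obj_def)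
  obtain f g where "conflation Z f Z g Z"
    using conflation_isomorphic [OF isomorphic_obj_refl [OF o] Z] .
  from K0_rel_class_conflation [OF this] show ?thesis
    using R.l_cancel_one' K0_rel_class_carrier [OF o] by auto
qed

lemma K0_rel_class_isomorphic:
  assumes iso: "isomorphic_obj \<C> A B"
  shows "K0_rel_class \<C> \<X> A = K0_rel_class \<C> \<X> B"
proof -
  interpret R: comm_group "K0_rel \<C> \<X>" by (rule comm_group_K0_rel)
  obtain Z where Z: "is_zero_obj \<C> Z" using zero_obj_exists by blast
  obtain f g where c: "conflation A f B g Z"
    using conflation_isomorphic [OF iso Z] .
  show ?thesis
    using K0_rel_class_conflation [OF c] K0_rel_class_zero [OF Z]
      K0_rel_class_carrier [OF conflation_Obj(1) [OF c]] by simp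
qed

lemma K0_split_class_zero:
  assumes Z: "is_zero_obj \<C> Z"
  shows "K0_split_class \<C> \<X> Z = \<one>\<^bsub>K0_split \<C> \<X>\<^esub>"
proof -
  interpret S: comm_group "K0_split \<C> \<X>" by (rule comm_group_K0_split)
  have "Z \<in> \<X>" by (rule zero_mem [OF Z])
  then show ?thesis
    using K0_split_class_direct_sum [OF _ _ is_direct_sum_zero [OF Z]] mem_Obj
      K0_split_class_carrier S.l_cancel_one' by metis
qed

text \<open>
  \<open>has_index m C v\<close>: some \<open>\<X>\<close>-resolution \<open>X\<^sub>m \<rightarrow> \<dots> \<rightarrow> X\<^sub>0 \<rightarrow> C\<close> has alternating sum \<open>v\<close>. Peeling off
  one conflation at a time turns the alternating sum into the recursion \<open>v = [X\<^sub>0] - w\<close>.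
\<close>

primrec has_index :: "nat \<Rightarrow> 'o \<Rightarrow> ('o set \<Rightarrow>\<^sub>0 int) set \<Rightarrow> bool" where
  "has_index 0 C v \<longleftrightarrow> C \<in> \<X> \<and> v = K0_split_class \<C> \<X> C"
| "has_index (Suc m) C v \<longleftrightarrow> (\<exists>K f X g w. X \<in> \<X> \<and> conflation K f X g C \<and> has_index m K w \<and>
     v = K0_split_class \<C> \<X> X \<otimes>\<^bsub>K0_split \<C> \<X>\<^esub> inv\<^bsub>K0_split \<C> \<X>\<^esub> w)"

lemma has_index_SucI:
  "\<lbrakk>X \<in> \<X>; conflation K f X g C; has_index m K w\<rbrakk>
    \<Longrightarrow> has_index (Suc m) C (K0_split_class \<C> \<X> X \<otimes>\<^bsub>K0_split \<C> \<X>\<^esub> inv\<^bsub>K0_split \<C> \<X>\<^esub> w)"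
  by (simp only: has_index.simps) blast

lemma has_index_carrier: "has_index m C v \<Longrightarrow> v \<in> carrier (K0_split \<C> \<X>)"
proof (induction m arbitrary: C v)
  case 0
  then show ?case using K0_split_class_carrier by auto
next
  case (Suc m)
  interpret S: comm_group "K0_split \<C> \<X>" by (rule comm_group_K0_split)
  show ?case using Suc K0_split_class_carrier by auto
qed

lemma has_index_Obj: "has_index m C v \<Longrightarrow> C \<in> Obj \<C>"
  by (cases m) (auto dest: mem_Obj conflation_Obj)

text \<open>
  Pulling the first conflation \<open>L \<rightarrow> Y \<rightarrow> K\<close> back along the split projection \<open>W \<rightarrow> K\<close> adds \<open>X\<close> to
  its middle term and keeps the kernel \<open>L\<close>.
\<close>

lemma has_index_direct_sum:
  assumes K: "has_index m K v" and X: "X \<in> \<X>" and sum: "is_direct_sum \<C> K X W"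
  shows "has_index m W (v \<otimes>\<^bsub>K0_split \<C> \<X>\<^esub> K0_split_class \<C> \<X> X)"
proof (cases m)
  case 0
  then show ?thesis
    using K direct_sum_mem [OF _ X sum] K0_split_class_direct_sum [OF _ X sum] by simp
next
  case (Suc l)
  interpret S: comm_group "K0_split \<C> \<X>" by (rule comm_group_K0_split)
  obtain L f Y g w where Y: "Y \<in> \<X>" and c: "conflation L f Y g K" and w: "has_index l L w"
    and v: "v = K0_split_class \<C> \<X> Y \<otimes>\<^bsub>K0_split \<C> \<X>\<^esub> inv\<^bsub>K0_split \<C> \<X>\<^esub> w"
    using K Suc by auto
  obtain i p where "conflation X i W p K"
    using conflation_direct_sum [OF sum] .
  then obtain V a b where V: "is_direct_sum \<C> X Y V" and c': "conflation L a V b W"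
    using conflation_pullback [OF _ c Y] by blast
  have "V \<in> \<X>" "K0_split_class \<C> \<X> V = K0_split_class \<C> \<X> X \<otimes>\<^bsub>K0_split \<C> \<X>\<^esub> K0_split_class \<C> \<X> Y"
    using direct_sum_mem [OF X Y V] K0_split_class_direct_sum [OF X Y V] by auto
  moreover have "v \<otimes>\<^bsub>K0_split \<C> \<X>\<^esub> K0_split_class \<C> \<X> X =
    (K0_split_class \<C> \<X> X \<otimes>\<^bsub>K0_split \<C> \<X>\<^esub> K0_split_class \<C> \<X> Y) \<otimes>\<^bsub>K0_split \<C> \<X>\<^esub> inv\<^bsub>K0_split \<C> \<X>\<^esub> w"
    unfolding v using S.m_ac K0_split_class_carrier [OF X] K0_split_class_carrier [OF Y]
      has_index_carrier [OF w] by simp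
  ultimately show ?thesis
    using has_index_SucI [OF _ c' w] Suc by simp
qed

text \<open>
  Let \<open>K\<^sub>A\<close>, \<open>K\<^sub>B\<close>, \<open>K\<^sub>C\<close> be the first kernels of the three resolutions. Pulling back
  \<open>A \<rightarrow> B \<rightarrow> C\<close> along \<open>X\<^sub>C \<rightarrow> C\<close> covers \<open>B\<close> by \<open>W = A \<oplus> X\<^sub>C\<close> with kernel \<open>K\<^sub>C\<close>. Two further
  pullbacks cover \<open>W\<close> by \<open>V = K\<^sub>C \<oplus> X\<^sub>B\<close> with kernel \<open>K\<^sub>B\<close>, and by \<open>U = X\<^sub>C \<oplus> X\<^sub>A\<close> with kernel
  \<open>K\<^sub>A\<close>. Comparing these two covers as in Schanuel's lemma gives a conflation
  \<open>K\<^sub>A \<rightarrow> K\<^sub>B \<oplus> U \<rightarrow> V\<close>, to which the induction hypothesis applies: adding objects of \<open>\<X>\<close> to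
  \<open>K\<^sub>B\<close> and \<open>K\<^sub>C\<close> keeps the length of their resolutions. The resulting equation
  \<open>[K\<^sub>B] + [X\<^sub>C] + [X\<^sub>A] = [K\<^sub>A] + [K\<^sub>C] + [X\<^sub>B]\<close> of indices is the claim.
\<close>

lemma has_index_conflation:
  assumes "conflation A f B g C" "has_index m A a" "has_index m B b" "has_index m C c"
  shows "b = a \<otimes>\<^bsub>K0_split \<C> \<X>\<^esub> c"
  using assms
proof (induction m arbitrary: A f B g C a b c)
  case 0
  then show ?case
    using K0_split_class_direct_sum [OF _ _ conflation_split [OF 0(1)]] by simp
next
  case (Suc m)
  interpret S: comm_group "K0_split \<C> \<X>" by (rule comm_group_K0_split)
  note c = Suc.prems(1)
  obtain KA fA XA gA wA where XA: "XA \<in> \<X>" and cA: "conflation KA fA XA gA A" and wA: "has_index m KA wA"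
    and a: "a = K0_split_class \<C> \<X> XA \<otimes>\<^bsub>K0_split \<C> \<X>\<^esub> inv\<^bsub>K0_split \<C> \<X>\<^esub> wA"
    using Suc.prems(2) by auto
  obtain KB fB XB gB wB where XB: "XB \<in> \<X>" and cB: "conflation KB fB XB gB B" and wB: "has_index m KB wB"
    and b: "b = K0_split_class \<C> \<X> XB \<otimes>\<^bsub>K0_split \<C> \<X>\<^esub> inv\<^bsub>K0_split \<C> \<X>\<^esub> wB"
    using Suc.prems(3) by auto
  obtain KC fC XC gC wC where XC: "XC \<in> \<X>" and cC: "conflation KC fC XC gC C" and wC: "has_index m KC wC"
    and c': "c = K0_split_class \<C> \<X> XC \<otimes>\<^bsub>K0_split \<C> \<X>\<^esub> inv\<^bsub>K0_split \<C> \<X>\<^esub> wC"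
    using Suc.prems(4) by auto
  obtain W a1 b1 where W: "is_direct_sum \<C> A XC W" and c1: "conflation KC a1 W b1 B"
    using conflation_pullback [OF c cC XC] .
  obtain V a2 b2 where V: "is_direct_sum \<C> KC XB V" and c2: "conflation KB a2 V b2 W"
    using conflation_pullback [OF c1 cB XB] .
  obtain i p where "conflation XC i W p A"
    using conflation_direct_sum [OF W] .
  then obtain U a3 b3 where U: "is_direct_sum \<C> XC XA U" and c3: "conflation KA a3 U b3 W"
    using conflation_pullback [OF _ cA XA] by blast
  have U': "U \<in> \<X>" "K0_split_class \<C> \<X> U = K0_split_class \<C> \<X> XC \<otimes>\<^bsub>K0_split \<C> \<X>\<^esub> K0_split_class \<C> \<X> XA"
    using direct_sum_mem [OF XC XA U] K0_split_class_direct_sum [OF XC XA U] by auto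
  obtain T a4 b4 where T: "is_direct_sum \<C> KB U T" and c4: "conflation KA a4 T b4 V"
    using conflation_pullback [OF c2 c3 U'(1)] .
  have eq: "wB \<otimes>\<^bsub>K0_split \<C> \<X>\<^esub> K0_split_class \<C> \<X> U =
    wA \<otimes>\<^bsub>K0_split \<C> \<X>\<^esub> (wC \<otimes>\<^bsub>K0_split \<C> \<X>\<^esub> K0_split_class \<C> \<X> XB)"
    by (rule Suc.IH [OF c4 wA has_index_direct_sum [OF wB U'(1) T] has_index_direct_sum [OF wC XB V]])
  show ?case
    unfolding a b c'
    by (rule S.sum_of_differences) (use eq U'(2) wA wB wC XA XB XC has_index_carrier K0_split_class_carrier in auto)
qed

lemma has_index_zero:
  assumes Z: "is_zero_obj \<C> Z"
  shows "has_index m Z \<one>\<^bsub>K0_split \<C> \<X>\<^esub>"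
proof (induction m)
  case 0
  then show ?case using zero_mem [OF Z] K0_split_class_zero [OF Z] by simp
next
  case (Suc m)
  interpret S: comm_group "K0_split \<C> \<X>" by (rule comm_group_K0_split)
  obtain f g where c: "conflation Z f Z g Z"
    using conflation_isomorphic [OF isomorphic_obj_refl [OF mem_Obj [OF zero_mem [OF Z]]] Z] .
  moreover have "\<one>\<^bsub>K0_split \<C> \<X>\<^esub> = K0_split_class \<C> \<X> Z \<otimes>\<^bsub>K0_split \<C> \<X>\<^esub> inv\<^bsub>K0_split \<C> \<X>\<^esub> \<one>\<^bsub>K0_split \<C> \<X>\<^esub>"
    using K0_split_class_zero [OF Z] by simp
  ultimately show ?case using has_index_SucI [OF zero_mem [OF Z] c Suc] by simp
qed

lemma has_index_mem:
  assumes X: "X \<in> \<X>"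
  shows "has_index m X (K0_split_class \<C> \<X> X)"
proof -
  interpret S: comm_group "K0_split \<C> \<X>" by (rule comm_group_K0_split)
  obtain Z where Z: "is_zero_obj \<C> Z" using zero_obj_exists by blast
  show ?thesis
    using has_index_direct_sum [OF has_index_zero [OF Z] X is_direct_sum_zero [OF Z mem_Obj [OF X]]]
      K0_split_class_carrier [OF X] by simp
qed

lemma has_index_isomorphic:
  assumes iso: "isomorphic_obj \<C> A B" and v: "has_index m A v" and w: "has_index m B w"
  shows "v = w"
proof -
  interpret S: comm_group "K0_split \<C> \<X>" by (rule comm_group_K0_split)
  obtain Z where Z: "is_zero_obj \<C> Z" using zero_obj_exists by blast
  obtain f g where "conflation A f B g Z"
    using conflation_isomorphic [OF iso Z] .
  from has_index_conflation [OF this v w has_index_zero [OF Z]] show ?thesis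
    using has_index_carrier [OF v] by simp
qed

lemma has_index_imp_rel_resolution:
  assumes "has_index m C v"
  obtains X d where "rel_resolution \<C> \<X> m C X d"
proof -
  have "\<exists>X d. rel_resolution \<C> \<X> m C X d"
    using assms
  proof (induction m arbitrary: C v)
    case 0
    then show ?case
      by (intro exI [of _ "\<lambda>_. C"] exI [of _ "\<lambda>_. Ide \<C> C"]) (auto simp: rel_resolution_def)
  next
    case (Suc m)
    then obtain K0 f0 X0 g0 w where X0: "X0 \<in> \<X>" and c: "conflation K0 f0 X0 g0 C" and w: "has_index m K0 w"
      by auto
    obtain X d where "rel_resolution \<C> \<X> m K0 X d"
      using Suc.IH [OF w] by blast
    then obtain K f g where X: "\<forall>i \<le> m. X i \<in> \<X>" and K: "K 0 = K0" "K m = X m" "g m = Ide \<C> (X m)"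
      and cs: "\<forall>i < m. conflation (K (Suc i)) (f i) (X i) (g i) (K i)"
      unfolding rel_resolution_def by blast
    let ?X = "case_nat X0 X" and ?K = "case_nat C K" and ?f = "case_nat f0 f" and ?g = "case_nat g0 g"
    have "rel_resolution \<C> \<X> (Suc m) C ?X (case_nat g0 (\<lambda>i. ?f i \<cdot> ?g (Suc i)))"
      unfolding rel_resolution_def
      by (intro conjI exI [of _ ?K] exI [of _ ?f] exI [of _ ?g])
        (use X0 c X K cs in \<open>auto split: nat.split simp: less_Suc_eq_0_disj\<close>)
    then show ?case by blast
  qed
  then show thesis using that by blast
qed

lemma rel_resolution_has_index:
  assumes "rel_resolution \<C> \<X> m C X d"
  shows "has_index m C (\<Otimes>\<^bsub>K0_split \<C> \<X>\<^esub>i \<in> {0..m}.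
    K0_split_class \<C> \<X> (X i) [^]\<^bsub>K0_split \<C> \<X>\<^esub> ((- 1) ^ i :: int))"
  using assms
proof (induction m arbitrary: C X d)
  case 0
  interpret S: comm_group "K0_split \<C> \<X>" by (rule comm_group_K0_split)
  have "C = X 0" "X 0 \<in> \<X>" using 0 by (auto simp: rel_resolution_def)
  then show ?case using K0_split_class_carrier by simp
next
  case (Suc m)
  interpret S: comm_group "K0_split \<C> \<X>" by (rule comm_group_K0_split)
  from Suc.prems obtain K f g where X: "\<forall>i \<le> Suc m. X i \<in> \<X>"
    and K: "K 0 = C" "K (Suc m) = X (Suc m)" "g (Suc m) = Ide \<C> (X (Suc m))"
    and cs: "\<forall>i < Suc m. conflation (K (Suc i)) (f i) (X i) (g i) (K i)"
    unfolding rel_resolution_def by blast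
  let ?t = "\<lambda>Y i. K0_split_class \<C> \<X> (Y i) [^]\<^bsub>K0_split \<C> \<X>\<^esub> ((- 1) ^ i :: int)"
  have "rel_resolution \<C> \<X> m (K 1) (X \<circ> Suc) (case_nat (g 1) (\<lambda>i. f (Suc i) \<cdot> g (Suc (Suc i))))"
    unfolding rel_resolution_def
    by (intro conjI exI [of _ "K \<circ> Suc"] exI [of _ "f \<circ> Suc"] exI [of _ "g \<circ> Suc"])
      (use X K cs in auto)
  from Suc.IH [OF this]
  have "has_index m (K 1) (finprod (K0_split \<C> \<X>) (?t (X \<circ> Suc)) {..m})"
    by (simp add: atMost_atLeast0)
  moreover have c: "X 0 \<in> \<X>" "conflation (K 1) (f 0) (X 0) (g 0) C"
    using cs K X by auto
  moreover have "finprod (K0_split \<C> \<X>) (?t X) {0..Suc m} =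
    K0_split_class \<C> \<X> (X 0) \<otimes>\<^bsub>K0_split \<C> \<X>\<^esub>
      inv\<^bsub>K0_split \<C> \<X>\<^esub> finprod (K0_split \<C> \<X>) (?t (X \<circ> Suc)) {..m}"
  proof -
    have cl: "K0_split_class \<C> \<X> (X i) \<in> carrier (K0_split \<C> \<X>)" if "i \<le> Suc m" for i
      using X that K0_split_class_carrier by blast
    have mem: "?t X \<in> {..Suc m} \<rightarrow> carrier (K0_split \<C> \<X>)"
      "?t (X \<circ> Suc) \<in> {..m} \<rightarrow> carrier (K0_split \<C> \<X>)"
      using cl by auto
    have closed: "finprod (K0_split \<C> \<X>) (\<lambda>i. ?t X (Suc i)) {..m} \<in> carrier (K0_split \<C> \<X>)"
      using cl by (intro S.finprod_closed) auto
    have "inv\<^bsub>K0_split \<C> \<X>\<^esub> finprod (K0_split \<C> \<X>) (?t (X \<circ> Suc)) {..m} =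
      finprod (K0_split \<C> \<X>) (\<lambda>i. inv\<^bsub>K0_split \<C> \<X>\<^esub> ?t (X \<circ> Suc) i) {..m}"
      using mem(2)
    proof (induction m)
      case (Suc m)
      then have "?t (X \<circ> Suc) \<in> {..m} \<rightarrow> carrier (K0_split \<C> \<X>)"
        "?t (X \<circ> Suc) (Suc m) \<in> carrier (K0_split \<C> \<X>)"
        by (auto simp: Pi_def)
      then show ?case
        using Suc by (simp add: S.finprod_Suc S.inv_mult S.finprod_closed Pi_def)
    qed (auto simp: Pi_def)
    also have "\<dots> = finprod (K0_split \<C> \<X>) (\<lambda>i. ?t X (Suc i)) {..m}"
      using cl by (intro S.finprod_cong') (auto simp: S.int_pow_neg)
    finally show ?thesis
      using S.finprod_Suc2 [OF mem(1)] S.m_comm [OF closed cl [of 0]] cl [of 0]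
      by (simp add: atMost_atLeast0)
  qed
  ultimately show ?case using has_index_SucI by simp
qed

text \<open>
  Both composites are the identity on generators: an object of \<open>\<X>\<close> is its own index, and the
  conflations of a resolution of \<open>C\<close> express \<open>[C]\<close> in the relative group as the alternating sum of the
  classes of its terms.
\<close>

theorem K0_rel_isomorphic_K0_split:
  assumes index: "\<And>C. C \<in> Obj \<C> \<Longrightarrow> \<exists>v. has_index m C v"
  obtains \<Phi> \<Psi> where "group_isomorphisms (K0_rel \<C> \<X>) (K0_split \<C> \<X>) \<Phi> \<Psi>"
    "\<And>C v. has_index m C v \<Longrightarrow> \<Phi> (K0_rel_class \<C> \<X> C) = v"
    "\<And>X. X \<in> \<X> \<Longrightarrow> \<Psi> (K0_split_class \<C> \<X> X) = K0_rel_class \<C> \<X> X"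
proof -
  let ?R = "K0_rel \<C> \<X>" and ?S = "K0_split \<C> \<X>"
  let ?cl = "iso_class \<C> (Obj \<C>)" and ?clX = "iso_class \<C> \<X>"
  interpret R: comm_group ?R by (rule comm_group_K0_rel)
  interpret S: comm_group ?S by (rule comm_group_K0_split)
  have cl_eq: "isomorphic_obj \<C> C C'" if "C' \<in> \<S>" "\<S> \<subseteq> Obj \<C>" "iso_class \<C> \<S> C = iso_class \<C> \<S> C'" for \<S> C C'
  proof -
    have "C' \<in> iso_class \<C> \<S> C'" using that isomorphic_obj_refl by (auto simp: iso_class_def)
    then show ?thesis using that(3) by (auto simp: iso_class_def)
  qed
  \<comment> \<open>The generators are isomorphism classes, so the index and the class are read off a chosen
    representative.\<close>
  define \<phi> where "\<phi> c = (SOME v. \<exists>C. c = ?cl C \<and> has_index m C v)" for c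
  have \<phi>: "\<phi> (?cl C) = v" if v: "has_index m C v" for C v
    unfolding \<phi>_def
  proof (rule some_equality)
    fix w assume "\<exists>C'. ?cl C = ?cl C' \<and> has_index m C' w"
    then show "w = v"
      using cl_eq [of _ "Obj \<C>" C] has_index_Obj has_index_isomorphic [OF _ v] by blast
  qed (use v in blast)
  obtain \<Phi> where \<Phi>: "\<Phi> \<in> hom ?R ?S" and \<Phi>_cl: "\<And>c. c \<in> ?cl ` Obj \<C> \<Longrightarrow>
      \<Phi> (presented_class (?cl ` Obj \<C>) (K0_rel_relations \<C> \<X>) c) = \<phi> c"
  proof -
    have mem: "\<phi> ` (?cl ` Obj \<C>) \<subseteq> carrier ?S"
      using index \<phi> has_index_carrier by (auto simp: image_iff) metis
    show thesis
    proof (rule presented_group_universal [OF K0_rel_relations_carrier comm_group_K0_split mem])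
      fix h r
      assume "group_hom (free_Abelian_group (?cl ` Obj \<C>)) ?S h"
        and h: "\<And>a. a \<in> ?cl ` Obj \<C> \<Longrightarrow> h (frag_of a) = \<phi> a" and r: "r \<in> K0_rel_relations \<C> \<X>"
      then interpret h: group_hom "free_Abelian_group (?cl ` Obj \<C>)" ?S h by simp
      obtain A f B g C where c: "conflation A f B g C"
        and r': "r = frag_of (?cl A) - frag_of (?cl B) + frag_of (?cl C)"
        using r unfolding K0_rel_relations_def by blast
      note o = conflation_Obj [OF c]
      obtain a b c' where ind: "has_index m A a" "has_index m B b" "has_index m C c'"
        using index [OF o(1)] index [OF o(2)] index [OF o(3)] by metis
      have carr: "r \<in> carrier (free_Abelian_group (?cl ` Obj \<C>))"
        using r K0_rel_relations_carrier by blast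
      have h_sum: "r + frag_of (?cl B) = frag_of (?cl A) + frag_of (?cl C)"
        by (simp add: r')
      have "h r \<otimes>\<^bsub>?S\<^esub> h (frag_of (?cl B)) = h (frag_of (?cl A) + frag_of (?cl C))"
        using h.hom_mult [OF carr, of "frag_of (?cl B)"] o h_sum by simp
      also have "\<dots> = h (frag_of (?cl A)) \<otimes>\<^bsub>?S\<^esub> h (frag_of (?cl C))"
        using h.hom_mult [of "frag_of (?cl A)" "frag_of (?cl C)"] o by simp
      finally have "h r \<otimes>\<^bsub>?S\<^esub> b = a \<otimes>\<^bsub>?S\<^esub> c'"
        using h \<phi> ind o by simp
      then show "h r = \<one>\<^bsub>?S\<^esub>"
        using has_index_conflation [OF c ind] S.r_cancel_one' has_index_carrier [OF ind(2)]
          h.hom_closed [OF carr] by metis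
    qed (use that in \<open>auto simp: K0_rel_def\<close>)
  qed
  have \<Phi>_class: "\<Phi> (K0_rel_class \<C> \<X> C) = v" if "has_index m C v" for C v
    using \<Phi>_cl [of "?cl C"] has_index_Obj [OF that] \<phi> [OF that] by (simp add: K0_rel_class_def)
  define \<psi> where "\<psi> c = (SOME v. \<exists>X \<in> \<X>. c = ?clX X \<and> v = K0_rel_class \<C> \<X> X)" for c
  have \<psi>: "\<psi> (?clX X) = K0_rel_class \<C> \<X> X" if X: "X \<in> \<X>" for X
    unfolding \<psi>_def
  proof (rule some_equality)
    fix w assume "\<exists>Y \<in> \<X>. ?clX X = ?clX Y \<and> w = K0_rel_class \<C> \<X> Y"
    then show "w = K0_rel_class \<C> \<X> X"
      using cl_eq [OF _ subcategory_Obj] K0_rel_class_isomorphic by metis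
  qed (use X in blast)
  obtain \<Psi> where \<Psi>: "\<Psi> \<in> hom ?S ?R" and \<Psi>_cl: "\<And>c. c \<in> ?clX ` \<X> \<Longrightarrow>
      \<Psi> (presented_class (?clX ` \<X>) (K0_split_relations \<C> \<X>) c) = \<psi> c"
  proof -
    have mem: "\<psi> ` (?clX ` \<X>) \<subseteq> carrier ?R"
      using \<psi> K0_rel_class_carrier mem_Obj by auto
    show thesis
    proof (rule presented_group_universal [OF K0_split_relations_carrier comm_group_K0_rel mem])
      fix h r
      assume "group_hom (free_Abelian_group (?clX ` \<X>)) ?R h"
        and h: "\<And>a. a \<in> ?clX ` \<X> \<Longrightarrow> h (frag_of a) = \<psi> a" and r: "r \<in> K0_split_relations \<C> \<X>"
      then interpret h: group_hom "free_Abelian_group (?clX ` \<X>)" ?R h by simp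
      obtain X Y S where X: "X \<in> \<X>" "Y \<in> \<X>" "S \<in> \<X>" and sum: "is_direct_sum \<C> X Y S"
        and r': "r = frag_of (?clX S) - (frag_of (?clX X) + frag_of (?clX Y))"
        using r unfolding K0_split_relations_def by blast
      let ?xy = "frag_of (?clX X) + frag_of (?clX Y)"
      obtain f g where c: "conflation Y f S g X"
        using conflation_direct_sum [OF sum] .
      have carr: "r \<in> carrier (free_Abelian_group (?clX ` \<X>))"
          "?xy \<in> carrier (free_Abelian_group (?clX ` \<X>))"
        using subsetD [OF K0_split_relations_carrier r] X
        by (auto dest!: subsetD [OF keys_add] split: if_splits)
      have xy: "h ?xy = K0_rel_class \<C> \<X> X \<otimes>\<^bsub>?R\<^esub> K0_rel_class \<C> \<X> Y"
        using h.hom_mult [of "frag_of (?clX X)" "frag_of (?clX Y)"] h \<psi> X by simp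
      have "h r \<otimes>\<^bsub>?R\<^esub> h ?xy = h (frag_of (?clX S))"
        using h.hom_mult [OF carr] r' by simp
      also have "\<dots> = h ?xy"
        using h \<psi> X xy K0_rel_class_conflation [OF c] R.m_comm K0_rel_class_carrier mem_Obj by simp
      finally show "h r = \<one>\<^bsub>?R\<^esub>"
        using h.hom_closed [OF carr(1)] h.hom_closed [OF carr(2)] R.r_cancel_one by blast
    qed (use that in \<open>auto simp: K0_split_def\<close>)
  qed
  have \<Psi>_class: "\<Psi> (K0_split_class \<C> \<X> X) = K0_rel_class \<C> \<X> X" if "X \<in> \<X>" for X
    using \<Psi>_cl [of "?clX X"] that \<psi> by (simp add: K0_split_class_def)
  interpret \<Psi>: group_hom ?S ?R \<Psi>
    by (simp add: group_hom_def group_hom_axioms_def \<Psi> R.is_group S.is_group)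
  have \<Psi>_index: "\<Psi> v = K0_rel_class \<C> \<X> C" if "has_index l C v" for l C v
    using that
  proof (induction l arbitrary: C v)
    case 0
    then show ?case using \<Psi>_class by simp
  next
    case (Suc l)
    then obtain K f X g w where X: "X \<in> \<X>" and c: "conflation K f X g C" and w: "has_index l K w"
      and v: "v = K0_split_class \<C> \<X> X \<otimes>\<^bsub>?S\<^esub> inv\<^bsub>?S\<^esub> w"
      by auto
    note o = conflation_Obj [OF c]
    have "\<Psi> v = K0_rel_class \<C> \<X> X \<otimes>\<^bsub>?R\<^esub> inv\<^bsub>?R\<^esub> K0_rel_class \<C> \<X> K"
      unfolding v using \<Psi>.hom_mult \<Psi>.hom_inv \<Psi>_class [OF X] Suc.IH [OF w] K0_split_class_carrier [OF X]
        has_index_carrier [OF w] by simp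
    also have "\<dots> = K0_rel_class \<C> \<X> C"
      unfolding K0_rel_class_conflation [OF c]
      using K0_rel_class_carrier o R.m_comm [of "K0_rel_class \<C> \<X> K" "K0_rel_class \<C> \<X> C"]
      by (simp add: R.m_assoc)
    finally show ?case .
  qed
  have "\<Psi> (\<Phi> x) = x" if "x \<in> carrier ?R" for x
  proof -
    have "(\<Psi> \<circ> \<Phi>) x = id x"
    proof (rule presented_group_hom_eq [OF K0_rel_relations_carrier R.is_group,
        where \<Phi> = "\<Psi> \<circ> \<Phi>" and \<Psi> = id])
      show "\<Psi> \<circ> \<Phi> \<in> hom (presented_group (?cl ` Obj \<C>) (K0_rel_relations \<C> \<X>)) ?R"
        using Group.hom_compose [OF \<Phi> \<Psi>] by (simp add: K0_rel_def)
      show "id \<in> hom (presented_group (?cl ` Obj \<C>) (K0_rel_relations \<C> \<X>)) ?R"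
        by (auto simp: hom_def K0_rel_def)
      show "x \<in> carrier (presented_group (?cl ` Obj \<C>) (K0_rel_relations \<C> \<X>))"
        using that by (simp add: K0_rel_def)
    next
      fix c assume "c \<in> ?cl ` Obj \<C>"
      then obtain C where C: "C \<in> Obj \<C>" "c = ?cl C" by blast
      obtain v where v: "has_index m C v" using index [OF C(1)] by blast
      show "(\<Psi> \<circ> \<Phi>) (presented_class (?cl ` Obj \<C>) (K0_rel_relations \<C> \<X>) c) =
          id (presented_class (?cl ` Obj \<C>) (K0_rel_relations \<C> \<X>) c)"
        using \<Phi>_class [OF v] \<Psi>_index [OF v] C(2) by (simp add: K0_rel_class_def)
    qed
    then show ?thesis by simp
  qed
  moreover have "\<Phi> (\<Psi> y) = y" if "y \<in> carrier ?S" for y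
  proof -
    have "(\<Phi> \<circ> \<Psi>) y = id y"
    proof (rule presented_group_hom_eq [OF K0_split_relations_carrier S.is_group,
        where \<Phi> = "\<Phi> \<circ> \<Psi>" and \<Psi> = id])
      show "\<Phi> \<circ> \<Psi> \<in> hom (presented_group (?clX ` \<X>) (K0_split_relations \<C> \<X>)) ?S"
        using Group.hom_compose [OF \<Psi> \<Phi>] by (simp add: K0_split_def)
      show "id \<in> hom (presented_group (?clX ` \<X>) (K0_split_relations \<C> \<X>)) ?S"
        by (auto simp: hom_def K0_split_def)
      show "y \<in> carrier (presented_group (?clX ` \<X>) (K0_split_relations \<C> \<X>))"
        using that by (simp add: K0_split_def)
    next
      fix c assume "c \<in> ?clX ` \<X>"
      then obtain X where X: "X \<in> \<X>" "c = ?clX X" by blast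
      show "(\<Phi> \<circ> \<Psi>) (presented_class (?clX ` \<X>) (K0_split_relations \<C> \<X>) c) =
          id (presented_class (?clX ` \<X>) (K0_split_relations \<C> \<X>) c)"
        using \<Phi>_class [OF has_index_mem [OF X(1)]] \<Psi>_class [OF X(1)] X(2) by (simp add: K0_split_class_def)
    qed
    then show ?thesis by simp
  qed
  ultimately have "group_isomorphisms ?R ?S \<Phi> \<Psi>"
    using \<Phi> \<Psi> by (simp add: group_isomorphisms_def)
  then show thesis using that \<Phi>_class \<Psi>_class by blast
qed

end

section \<open>Cluster tilting subcategories\<close>

context triangulated_category
begin

lemma Hom_Sh_pow_direct_sum:
  assumes sum: "is_direct_sum \<C> A B S"
    and A: "Hom \<C> U ((Sh \<C> ^^ i) A) = {Zero \<C> U ((Sh \<C> ^^ i) A)}"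
    and B: "Hom \<C> U ((Sh \<C> ^^ i) B) = {Zero \<C> U ((Sh \<C> ^^ i) B)}"
  shows "Hom \<C> U ((Sh \<C> ^^ i) S) = {Zero \<C> U ((Sh \<C> ^^ i) S)}"
proof -
  let ?A = "(Sh \<C> ^^ i) A" and ?B = "(Sh \<C> ^^ i) B" and ?S = "(Sh \<C> ^^ i) S"
  obtain k l p q where kl: "k \<in> Hom \<C> ?A ?S" "l \<in> Hom \<C> ?B ?S" "p \<in> Hom \<C> ?S ?A" "q \<in> Hom \<C> ?S ?B"
    and Ide: "Add \<C> (k \<cdot> p) (l \<cdot> q) = Ide \<C> ?S"
    using Sh_pow_direct_sum [OF sum] unfolding is_direct_sum_def by blast
  have U: "U \<in> Obj \<C>" "?S \<in> Obj \<C>" using A Hom_Obj kl(1) by blast+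
  have "y = Zero \<C> U ?S" if y: "y \<in> Hom \<C> U ?S" for y
  proof -
    have "p \<cdot> y = Zero \<C> U ?A" "q \<cdot> y = Zero \<C> U ?B"
      using A B Comp_Hom [OF y kl(3)] Comp_Hom [OF y kl(4)] by auto
    then have "Add \<C> (k \<cdot> p) (l \<cdot> q) \<cdot> y = Zero \<C> U ?S"
      using Add_Comp [OF y Comp_Hom [OF kl(3,1)] Comp_Hom [OF kl(4,2)]] Comp_assoc [OF y kl(3,1)]
        Comp_assoc [OF y kl(4,2)] Comp_Zero [OF kl(1) U(1)] Comp_Zero [OF kl(2) U(1)]
        Add_Zero [OF Zero_Hom [OF U]] by simp
    then show ?thesis using Ide Ide_Comp [OF y] by simp
  qed
  then show ?thesis using Zero_Hom [OF U] by blast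
qed

text \<open>
  Of the two descriptions of \<open>\<X>\<close> as an orthogonal, this one fits resolutions, whose kernels are
  tested by maps from \<open>\<X>\<close>.
\<close>

lemma cluster_tilting_mem_iff:
  assumes "cluster_tilting \<C> n \<X>"
  shows "C \<in> \<X> \<longleftrightarrow> C \<in> Obj \<C> \<and>
    (\<forall>X \<in> \<X>. \<forall>i \<in> {1..n-1}. Hom \<C> X ((Sh \<C> ^^ i) C) = {Zero \<C> X ((Sh \<C> ^^ i) C)})"
  using assms unfolding cluster_tilting_def by blast

lemma cluster_tilting_additive_subcategory:
  assumes ct: "cluster_tilting \<C> n \<X>"
  shows "additive_subcategory \<C> \<X>"
proof unfold_locales
  show sub: "\<X> \<subseteq> Obj \<C>"
    using ct by (simp add: cluster_tilting_def)
  show "Z \<in> \<X>" if Z: "is_zero_obj \<C> Z" for Z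
    unfolding cluster_tilting_mem_iff [OF ct, of Z]
    using Sh_pow_zero_obj [OF Z] Z sub by (auto simp: is_zero_obj_def)
  show "S \<in> \<X>" if "X \<in> \<X>" "Y \<in> \<X>" and sum: "is_direct_sum \<C> X Y S" for X Y S
    unfolding cluster_tilting_mem_iff [OF ct, of S]
    using is_direct_sum_Obj [OF sum] Hom_Sh_pow_direct_sum [OF sum] that(1,2)
    unfolding cluster_tilting_mem_iff [OF ct, of X] cluster_tilting_mem_iff [OF ct, of Y] by blast
qed

end

text \<open>
  Dimension shifting: replacing \<open>C\<close> by the cocone of a right \<open>\<X>\<close>-approximation makes one more
  \<open>\<C>(\<X>, C[i])\<close> vanish, so that after \<open>n - 1\<close> steps the cocone lies in \<open>\<X>\<close>. An object with
  \<open>m\<close> steps to go therefore has \<open>\<C>(\<X>, C[i]) = 0\<close> for \<open>1 \<le> i \<le> n - 1 - m\<close>.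
\<close>

lemma (in additive_subcategory) cluster_tilting_has_index:
  assumes ct: "cluster_tilting \<C> n \<X>" and "m \<le> n - 1" and "C \<in> Obj \<C>"
    and "\<And>X i. \<lbrakk>X \<in> \<X>; 1 \<le> i; i \<le> n - 1 - m\<rbrakk>
      \<Longrightarrow> Hom \<C> X ((Sh \<C> ^^ i) C) = {Zero \<C> X ((Sh \<C> ^^ i) C)}"
  shows "\<exists>v. has_index m C v"
  using assms(2-4)
proof (induction m arbitrary: C)
  case 0
  then have "C \<in> \<X>"
    unfolding cluster_tilting_mem_iff [OF ct, of C] by auto
  then show ?case by simp
next
  case (Suc m)
  obtain X0 x where X0: "X0 \<in> \<X>" and x: "x \<in> Hom \<C> X0 C"
    and approx: "\<And>Y y. \<lbrakk>Y \<in> \<X>; y \<in> Hom \<C> Y C\<rbrakk> \<Longrightarrow> \<exists>z \<in> Hom \<C> Y X0. y = x \<cdot> z"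
  proof -
    have "contravariantly_finite \<C> \<X>"
      using ct by (simp add: cluster_tilting_def functorially_finite_def)
    then show thesis
      using that Suc.prems(2) unfolding contravariantly_finite_def by blast
  qed
  obtain K u k where u: "u \<in> Hom \<C> K X0" and k: "k \<in> Hom \<C> C (Sh \<C> K)" and D: "Dist \<C> u x k"
    using Dist_cocone [OF x] .
  have o: "K \<in> Obj \<C>" "Sh \<C> K \<in> Obj \<C>" using Hom_Obj u k by blast+
  have kx: "k \<cdot> x = Zero \<C> X0 (Sh \<C> K)"
    using Dist_Comp_Zero [OF Dist_rotate [OF D u x k] x k] .
  have k0: "k \<cdot> y = Zero \<C> Y (Sh \<C> K)" if y: "Y \<in> \<X>" "y \<in> Hom \<C> Y C" for Y y
  proof -
    obtain z where z: "z \<in> Hom \<C> Y X0" "y = x \<cdot> z" using approx [OF y] by blast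
    then show ?thesis using Comp_assoc [OF z(1) x k] kx Zero_Comp [OF z(1) o(2)] by simp
  qed
  have c: "conflation K u X0 x C"
    using conflationI [OF D u x k] k0 by blast
  have X0_zero: "Hom \<C> Y ((Sh \<C> ^^ i) X0) = {Zero \<C> Y ((Sh \<C> ^^ i) X0)}" if "Y \<in> \<X>" "1 \<le> i" "i \<le> n - 1" for Y i
    using that X0 unfolding cluster_tilting_mem_iff [OF ct, of X0] by simp
  have "Hom \<C> Y ((Sh \<C> ^^ i) K) = {Zero \<C> Y ((Sh \<C> ^^ i) K)}"
    if Y: "Y \<in> \<X>" and i: "1 \<le> i" "i \<le> n - 1 - m" for Y i
  proof -
    obtain t where t: "i = Suc t" using i by (cases i) auto
    have oY: "Y \<in> Obj \<C>" by (rule mem_Obj [OF Y])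
    \<comment> \<open>In the triangle shifted by \<open>t\<close>, the connecting map \<open>k'\<close> kills all maps from \<open>Y\<close>: for \<open>t = 0\<close>
      because \<open>x\<close> is an approximation, for \<open>t > 0\<close> because there are none but zero.\<close>
    obtain u' x' k' where D': "Dist \<C> u' x' k'"
      and u': "u' \<in> Hom \<C> ((Sh \<C> ^^ t) K) ((Sh \<C> ^^ t) X0)"
      and x': "x' \<in> Hom \<C> ((Sh \<C> ^^ t) X0) ((Sh \<C> ^^ t) C)"
      and k': "k' \<in> Hom \<C> ((Sh \<C> ^^ t) C) (Sh \<C> ((Sh \<C> ^^ t) K))"
      and k'0: "\<And>z. z \<in> Hom \<C> Y ((Sh \<C> ^^ t) C) \<Longrightarrow> k' \<cdot> z = Zero \<C> Y (Sh \<C> ((Sh \<C> ^^ t) K))"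
    proof (cases "t = 0")
      case True
      then show thesis using that [OF D] u x k k0 [OF Y] by simp
    next
      case False
      obtain u' x' k' where D': "Dist \<C> u' x' k'"
        and u': "u' \<in> Hom \<C> ((Sh \<C> ^^ t) K) ((Sh \<C> ^^ t) X0)"
        and x': "x' \<in> Hom \<C> ((Sh \<C> ^^ t) X0) ((Sh \<C> ^^ t) C)"
        and k': "k' \<in> Hom \<C> ((Sh \<C> ^^ t) C) (Sh \<C> ((Sh \<C> ^^ t) K))"
        using Dist_Sh_pow [OF D u x k] .
      have "Hom \<C> Y ((Sh \<C> ^^ t) C) = {Zero \<C> Y ((Sh \<C> ^^ t) C)}"
        using Suc.prems(3) [OF Y, of t] False i t by simp
      then show thesis
        using that [OF D' u' x' k'] Comp_Zero [OF k' oY] by simp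
    qed
    have nu: "Neg \<C> (ShArr \<C> u') \<in> Hom \<C> (Sh \<C> ((Sh \<C> ^^ t) K)) (Sh \<C> ((Sh \<C> ^^ t) X0))"
      by (rule Neg_Hom [OF ShArr_Hom [OF u']])
    have "y = Zero \<C> Y ((Sh \<C> ^^ i) K)" if "y \<in> Hom \<C> Y ((Sh \<C> ^^ i) K)" for y
    proof -
      have y: "y \<in> Hom \<C> Y (Sh \<C> ((Sh \<C> ^^ t) K))" using that t by simp
      have "Neg \<C> (ShArr \<C> u') \<cdot> y = Zero \<C> Y (Sh \<C> ((Sh \<C> ^^ t) X0))"
        using X0_zero [OF Y i(1)] i Comp_Hom [OF y nu] t by auto
      then obtain z where "z \<in> Hom \<C> Y ((Sh \<C> ^^ t) C)" "k' \<cdot> z = y"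
        using Dist_lift_right [OF Dist_rotate [OF D' u' x' k'] x' k' nu y] by blast
      then show ?thesis using k'0 t by auto
    qed
    then show ?thesis using Zero_Hom [OF oY Sh_pow_Obj [OF o(1)]] by blast
  qed
  then obtain w where "has_index m K w"
    using Suc.IH [of K] Suc.prems(1) o by auto
  then show ?case using has_index_SucI [OF X0 c] by blast
qed

theorem corollary5p5:
  fixes \<C> :: "('o, 'm) triangulated_category" and \<X> :: "'o set" and n :: nat
  assumes "triangulated_category \<C>"
    and "idempotent_complete \<C>"
    and "n \<ge> 2"
    and "cluster_tilting \<C> n \<X>"
  shows "(\<forall>C \<in> Obj \<C>. \<exists>X d. rel_resolution \<C> \<X> (n - 1) C X d) \<and>
    (\<exists>\<Phi> \<Psi>. group_isomorphisms (K0_rel \<C> \<X>) (K0_split \<C> \<X>) \<Phi> \<Psi> \<and>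
      (\<forall>C \<in> Obj \<C>. \<forall>X d. rel_resolution \<C> \<X> (n - 1) C X d \<longrightarrow>
         \<Phi> (K0_rel_class \<C> \<X> C) =
           (\<Otimes>\<^bsub>K0_split \<C> \<X>\<^esub>i \<in> {0..n - 1}.
              K0_split_class \<C> \<X> (X i) [^]\<^bsub>K0_split \<C> \<X>\<^esub> ((- 1) ^ i :: int))) \<and>
      (\<forall>X \<in> \<X>. \<Psi> (K0_split_class \<C> \<X> X) = K0_rel_class \<C> \<X> X))"
proof -
  interpret additive_subcategory \<C> \<X>
    by (rule triangulated_category.cluster_tilting_additive_subcategory [OF assms(1,4)])
  have index: "\<exists>v. has_index (n - 1) C v" if "C \<in> Obj \<C>" for C
    by (rule cluster_tilting_has_index [OF assms(4) order_refl that]) simp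
  obtain \<Phi> \<Psi> where iso: "group_isomorphisms (K0_rel \<C> \<X>) (K0_split \<C> \<X>) \<Phi> \<Psi>"
    and \<Phi>: "\<And>C v. has_index (n - 1) C v \<Longrightarrow> \<Phi> (K0_rel_class \<C> \<X> C) = v"
    and \<Psi>: "\<And>X. X \<in> \<X> \<Longrightarrow> \<Psi> (K0_split_class \<C> \<X> X) = K0_rel_class \<C> \<X> X"
    using K0_rel_isomorphic_K0_split [OF index] by blast
  have "\<forall>C \<in> Obj \<C>. \<exists>X d. rel_resolution \<C> \<X> (n - 1) C X d"
    using index has_index_imp_rel_resolution by metis
  moreover have "\<forall>C \<in> Obj \<C>. \<forall>X d. rel_resolution \<C> \<X> (n - 1) C X d \<longrightarrow>
         \<Phi> (K0_rel_class \<C> \<X> C) =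
           (\<Otimes>\<^bsub>K0_split \<C> \<X>\<^esub>i \<in> {0..n - 1}.
              K0_split_class \<C> \<X> (X i) [^]\<^bsub>K0_split \<C> \<X>\<^esub> ((- 1) ^ i :: int))"
    using \<Phi> [OF rel_resolution_has_index] by blast
  ultimately show ?thesis
    using iso \<Psi> by blast
qed

end
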